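(* Let $\mathfrak{H}$, $\mathfrak{H}y$, $Z_q^t$, $\varphi_\hbar^t$, $S_\hbar^t$, $\ast$ and $\stackrel{t}{\circledast}_\hbar$ be as defined in the context below. For every integer $m\geq 1$ and all $v,w\in\mathfrak{H}y$, \[ \sum_{\substack{i+j=m\\ i,j\geq 1}} Z_q^t\bigl(\varphi_\hbar^t(v)\stackrel{t}{\circledast}_\hbar(-tx+y-\hbar t)^{i-1}y\bigr)\, Z_q^t\bigl(\varphi_\hbar^t(w)\stackrel{t}{\circledast}_\hbar(-tx+y-\hbar t)^{j-1}y\bigr) = -Z_q^t\Bigl(\varphi_\hbar^t\,(S_\hbar^t)^{-1}\bigl(S_\hbar^t(v)\ast S_\hbar^t(w)\bigr)\stackrel{t}{\circledast}_\hbar(-tx+y-\hbar t)^{m-1}y\Bigr). \]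
   Context: Let $q$, $t$ be formal parameters and $[n]=\frac{1-q^n}{1-q}$. For positive integers $k_1,\dots,k_l$ with $k_1\ge 2$ put $\zeta_q(k_1,\dots,k_l)=\sum_{m_1>m_2>\cdots>m_l\ge1}\prod_{a=1}^l \frac{q^{(k_a-1)m_a}}{[m_a]^{k_a}}\in\mathbb{Q}[[q]]$. The weight of an index $(k_1,\dots,k_l)$ is $k_1+\cdots+k_l$ and its depth is $l$. Define $\zeta_q^t(k_1,\dots,k_l)=\sum'_{\mathbf p}(1-q)^{k-\mathrm{wt}(\mathbf p)}\zeta_q(\mathbf p)\,t^{l-\mathrm{dep}(\mathbf p)}\in\mathbb{Q}[[q]][t]$, where $k=k_1+\cdots+k_l$ and $\mathbf p$ runs over all indices of the form $(k_1\ \square\ k_2\ \square\cdots\square\ k_l)$ in which each $\square$ is filled by one of the three symbols "," (comma), "$+$" or "$-1+$" (e.g. $(3\,{-1+}\,2, 1)=(4,1)$). Let $\hbar$ be a formal variable and $\mathfrak{H}=\mathbb{Q}[\hbar,t]\langle x,y\rangle$ the noncommutative polynomial algebra over $\mathbb{Q}[\hbar,t]$; put $\mathfrak{H}^1=\mathbb{Q}[\hbar,t]+\mathfrak{H}y$, $\mathfrak{H}^0=\mathbb{Q}[\hbar,t]+x\mathfrak{H}y$, and $z_j=x^{j-1}y$ ($j\ge1$). Let $\widehat Z_q^t:\mathfrak{H}^0\to\mathbb{Q}[\hbar,t][[q]]$ be the $\mathbb{Q}[\hbar,t]$-linear map with $\widehat Z_q^t(1)=1$ and $\widehat Z_q^t(z_{k_1}\cdots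 z_{k_l})=\zeta_q^t(k_1,\dots,k_l)$ ($k_1\ge2$), and let $Z_q^t=f\circ\widehat Z_q^t$ where $f$ substitutes $\hbar\mapsto 1-q$. Let $\mathfrak z$ be the $\mathbb{Q}[\hbar,t]$-span of $\{z_j\}_{j\ge1}$, with the bilinear product $z_i\circ_+ z_j=z_{i+j}+\hbar z_{i+j-1}$, extended to an action of $\mathfrak z$ on $\mathfrak{H}^1$ by $z_i\circ_+1=0$, $z_i\circ_+(z_jw)=(z_i\circ_+z_j)w$. Let $S_\hbar^t:\mathfrak{H}^1\to\mathfrak{H}^1$ be the $\mathbb{Q}[\hbar,t]$-linear map with $S_\hbar^t(1)=1$ and $S_\hbar^t(z_kw)=z_kS_\hbar^t(w)+t\,z_k\circ_+S_\hbar^t(w)$ for words $w\in\mathfrak{H}^1$ (it is bijective). Let $\varphi$ be the algebra automorphism of $\mathfrak{H}$ with $\varphi(x)=x+y$, $\varphi(y)=-y$, and $\varphi_\hbar^t=-(S_\hbar^t)^{-1}\varphi S_\hbar^t$. The harmonic product $\ast$ on $\mathfrak{H}^1$ is the $\mathbb{Q}[\hbar,t]$-bilinear product with $1\ast w=w\ast 1=w$ and $z_iu\ast z_jv=z_i(u\ast z_jv)+z_j(z_iu\ast v)+z_{i+j}(u\ast v)$ for words $u,v,w$. The product $\ast_+$ on $\mathfrak{H}^1$ is defined by the same rules with the last term replaced by $(z_i\circ_+z_j)(u\ast_+v)$. On $\mathfrak{H}y$ define $z_iu\circledast_\hbar z_jv=z_{i+j}(u\ast_+v)$ ($i,j\ge1$,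 $u,v\in\mathfrak{H}^1$, extended bilinearly) and $u\stackrel{t}{\circledast}_\hbar v=(S_\hbar^t)^{-1}\bigl(S_\hbar^t(u)\circledast_\hbar S_\hbar^t(v)\bigr)$. *)

theory Defs
  imports "HOL-Library.Poly_Mapping" "HOL-Computational_Algebra.Polynomial"
    "HOL-Computational_Algebra.Formal_Power_Series"
begin

text \<open>Q[hbar,t] is represented as (Q[hbar])[t] = rat poly poly:
  the outer polynomial variable is t, the inner one is hbar.\<close>
type_synonym coef = "rat poly poly"

definition hb :: coef where "hb = [:[:0, 1:]:]"
definition tv :: coef where "tv = [:0, 1:]"

datatype letter = X | Y

type_synonym H = "letter list \<Rightarrow>\<^sub>0 coef"

definition monoH :: "letter list \<Rightarrow> H" where
  "monoH u = Poly_Mapping.single u 1"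

definition smultH :: "coef \<Rightarrow> H \<Rightarrow> H" where
  "smultH c P = Poly_Mapping.map (\<lambda>a. c * a) P"

definition mulH :: "H \<Rightarrow> H \<Rightarrow> H" where
  "mulH P Q = (\<Sum>u\<in>Poly_Mapping.keys P. \<Sum>v\<in>Poly_Mapping.keys Q.
      Poly_Mapping.single (u @ v) (Poly_Mapping.lookup P u * Poly_Mapping.lookup Q v))"

fun powH :: "H \<Rightarrow> nat \<Rightarrow> H" where
  "powH P 0 = monoH []"
| "powH P (Suc n) = mulH P (powH P n)"

definition linH :: "(letter list \<Rightarrow> H) \<Rightarrow> H \<Rightarrow> H" where
  "linH f P = (\<Sum>u\<in>Poly_Mapping.keys P. smultH (Poly_Mapping.lookup P u) (f u))"

definition bilinH :: "(letter list \<Rightarrow> letter list \<Rightarrow> H) \<Rightarrow> H \<Rightarrow> H \<Rightarrow> H" where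
  "bilinH f P Q = (\<Sum>u\<in>Poly_Mapping.keys P. \<Sum>v\<in>Poly_Mapping.keys Q.
      smultH (Poly_Mapping.lookup P u * Poly_Mapping.lookup Q v) (f u v))"

definition H1 :: "H set" where
  "H1 = {P. \<forall>u\<in>Poly_Mapping.keys P. u = [] \<or> last u = Y}"

definition Hy :: "H set" where
  "Hy = {P. \<forall>u\<in>Poly_Mapping.keys P. u \<noteq> [] \<and> last u = Y}"

definition z :: "nat \<Rightarrow> letter list" where
  "z k = replicate (k - 1) X @ [Y]"

definition zw :: "nat list \<Rightarrow> letter list" where
  "zw ks = concat (map z ks)"

text \<open>For a word ending in y (or empty), the index list (k_1,...,k_l) with
  word = z_{k_1}...z_{k_l}.\<close>
fun ind :: "letter list \<Rightarrow> nat list" where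
  "ind [] = []"
| "ind (Y # w) = 1 # ind w"
| "ind (X # w) = (case ind w of [] \<Rightarrow> [] | k # ks \<Rightarrow> Suc k # ks)"

definition zcons :: "nat \<Rightarrow> H \<Rightarrow> H" where
  "zcons k P = mulH (monoH (z k)) P"

definition circw :: "nat \<Rightarrow> nat list \<Rightarrow> H" where
  "circw i ks = (case ks of [] \<Rightarrow> 0
     | j # ks' \<Rightarrow> monoH (zw ((i + j) # ks')) + smultH hb (monoH (zw ((i + j - 1) # ks'))))"

definition circH :: "nat \<Rightarrow> H \<Rightarrow> H" where
  "circH i P = linH (\<lambda>u. circw i (ind u)) P"

fun Sw :: "nat list \<Rightarrow> H" where
  "Sw [] = monoH []"
| "Sw (k # ks) = zcons k (Sw ks) + smultH tv (circH k (Sw ks))"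

definition S :: "H \<Rightarrow> H" where
  "S P = linH (\<lambda>u. Sw (ind u)) P"

definition Sinv :: "H \<Rightarrow> H" where
  "Sinv = inv_into H1 S"

fun phiw :: "letter list \<Rightarrow> H" where
  "phiw [] = monoH []"
| "phiw (X # w) = mulH (monoH [X] + monoH [Y]) (phiw w)"
| "phiw (Y # w) = mulH (- monoH [Y]) (phiw w)"

definition phi :: "H \<Rightarrow> H" where
  "phi P = linH phiw P"

definition phit :: "H \<Rightarrow> H" where
  "phit P = - Sinv (phi (S P))"

fun harm :: "nat list \<Rightarrow> nat list \<Rightarrow> H" where
  "harm [] v = monoH (zw v)"
| "harm u [] = monoH (zw u)"
| "harm (i # u) (j # v) = zcons i (harm u (j # v)) + zcons j (harm (i # u) v)
      + zcons (i + j) (harm u v)"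

fun harmP :: "nat list \<Rightarrow> nat list \<Rightarrow> H" where
  "harmP [] v = monoH (zw v)"
| "harmP u [] = monoH (zw u)"
| "harmP (i # u) (j # v) = zcons i (harmP u (j # v)) + zcons j (harmP (i # u) v)
      + zcons (i + j) (harmP u v) + smultH hb (zcons (i + j - 1) (harmP u v))"

definition star :: "H \<Rightarrow> H \<Rightarrow> H" where
  "star P Q = bilinH (\<lambda>a b. harm (ind a) (ind b)) P Q"

fun oastw :: "nat list \<Rightarrow> nat list \<Rightarrow> H" where
  "oastw (i # u) (j # v) = zcons (i + j) (harmP u v)"
| "oastw _ _ = 0"

definition oast :: "H \<Rightarrow> H \<Rightarrow> H" where
  "oast P Q = bilinH (\<lambda>a b. oastw (ind a) (ind b)) P Q"

definition oastt :: "H \<Rightarrow> H \<Rightarrow> H" where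
  "oastt P Q = Sinv (oast (S P) (S Q))"

definition qint :: "nat \<Rightarrow> rat fps" where
  "qint m = (\<Sum>i<m. fps_X ^ i)"

text \<open>zeta_q(k_1,...,k_l) for k_1 \<ge> 2, defined coefficientwise. The n-th coefficient
  only receives contributions from m_1 \<le> n, since the summand has q-order
  \<ge> (k_1-1) m_1 \<ge> m_1.\<close>
definition zq :: "nat list \<Rightarrow> rat fps" where
  "zq ks = Abs_fps (\<lambda>n. \<Sum>ms\<in>{ms. length ms = length ks \<and> sorted_wrt (>) ms
        \<and> (\<forall>m\<in>set ms. 1 \<le> m) \<and> (\<forall>m\<in>set ms. m \<le> n)}.
      fps_nth (\<Prod>a<length ks. fps_X ^ ((ks ! a - 1) * ms ! a)
                 * inverse (qint (ms ! a)) ^ (ks ! a)) n)"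

text \<open>Filling the boxes: choice 0 = comma, 1 = "+", 2 = "-1+".\<close>
fun fill :: "nat list \<Rightarrow> nat list \<Rightarrow> nat list" where
  "fill [] cs = []"
| "fill [k] cs = [k]"
| "fill (k1 # k2 # ks) cs =
     (case fill (k2 # ks) (tl cs) of [] \<Rightarrow> [] | p # ps \<Rightarrow>
        (if hd cs = 0 then k1 # p # ps else if hd cs = 1 then (k1 + p) # ps
         else (k1 + p - 1) # ps))"

definition zqt :: "nat list \<Rightarrow> rat fps poly" where
  "zqt ks = (\<Sum>cs\<in>{cs. length cs = length ks - 1 \<and> set cs \<subseteq> {0, 1, 2}}.
     monom ((1 - fps_X) ^ (sum_list ks - sum_list (fill ks cs)) * zq (fill ks cs))
           (length ks - length (fill ks cs)))"

definition fsub :: "coef \<Rightarrow> rat fps poly" where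
  "fsub c = map_poly (\<lambda>a. poly (map_poly fps_const a) (1 - fps_X)) c"

text \<open>Z_q^t on words of H^0 = Q[hbar,t] + x H y (junk value 0 elsewhere).\<close>
definition Zw :: "letter list \<Rightarrow> rat fps poly" where
  "Zw u = (if u = [] then 1 else if hd u = X \<and> last u = Y then zqt (ind u) else 0)"

definition Zqt :: "H \<Rightarrow> rat fps poly" where
  "Zqt P = (\<Sum>u\<in>Poly_Mapping.keys P. fsub (Poly_Mapping.lookup P u) * Zw u)"

definition Eel :: "H" where
  "Eel = smultH (- tv) (monoH [X]) + monoH [Y] - smultH (hb * tv) (monoH [])"

end

theory Submission
  imports Defs
begin

text \<open>Since \<open>S\<close> maps \<open>(-t x + y - \<hbar> t)^(i-1) y\<close> to \<open>y^i\<close>, everything reduces to \<open>t = 0\<close>. There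
  \<open>Z(\<phi>(V) \<circledast> y^i)\<close> is the coefficient of \<open>T^i\<close> in
  \<open>F_V(T) = \<Sum>m\<ge>1. q^m s_m(\<phi>(V)) (T/[m]) (\<Prod>r<m. 1 + T/[r])\<close>, where \<open>s_m\<close> is the part of the sum
  \<open>\<zeta>_q\<close> with largest index \<open>m\<close>. At \<open>T = -[n]\<close> this Newton series terminates, and by a \<open>q\<close>-analogue
  of Hoffman's duality its value is the nested sum of \<open>V\<close> up to \<open>n\<close> with summands \<open>(q^r/[r])^k\<close>.
  These finite sums are multiplicative for the harmonic product, so \<open>F_V F_W\<close> and \<open>F_(V*W)\<close> agree
  at all \<open>-[n]\<close>. Substituting \<open>T = (u - 1)/(1 - q)\<close> turns these points into \<open>u = q^n\<close>, which
  suffices for equality of the series; comparing coefficients of \<open>T^m\<close> gives the theorem.\<close>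

section \<open>Nested sums\<close>

text \<open>The summand stays abstract because two families are needed: \<open>geo\<close> on the
  dual side and \<open>fq\<close> for \<open>zq\<close>. The bound \<open>r - 1\<close> encodes
  strictly decreasing variables.\<close>

fun nsum :: "(nat \<Rightarrow> nat \<Rightarrow> 'a::comm_ring_1) \<Rightarrow> nat \<Rightarrow> nat list \<Rightarrow> 'a" where
  "nsum f n [] = 1"
| "nsum f n (k # ks) = (\<Sum>r=1..n. f k r * nsum f (r - 1) ks)"

text \<open>The part of \<open>nsum\<close> whose largest variable equals \<open>m\<close>; the
  empty index has no largest variable and gets 0.\<close>

fun nterm :: "(nat \<Rightarrow> nat \<Rightarrow> 'a::comm_ring_1) \<Rightarrow> nat \<Rightarrow> nat list \<Rightarrow> 'a" where
  "nterm f m [] = 0"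
| "nterm f m (k # ks) = f k m * nsum f (m - 1) ks"

lemma nsum_nterm: "ks \<noteq> [] \<Longrightarrow> nsum f n ks = (\<Sum>r=1..n. nterm f r ks)"
  by (cases ks) auto

text \<open>The square of pairs (r, s) is cut into s < r, r < s and r = s.\<close>

lemma sum_mult_sum_split:
  fixes a b :: "nat \<Rightarrow> 'a::comm_ring_1"
  shows "(\<Sum>r=1..n. a r) * (\<Sum>s=1..n. b s) =
    (\<Sum>r=1..n. a r * (\<Sum>s=1..r-1. b s)) + (\<Sum>r=1..n. b r * (\<Sum>s=1..r-1. a s))
      + (\<Sum>r=1..n. a r * b r)"
  by (induction n) (auto simp: algebra_simps)

lemma nsum_Cons_mult_Cons:
  "nsum f n (i # u) * nsum f n (j # v) =
    (\<Sum>r=1..n. f i r * (nsum f (r - 1) u * nsum f (r - 1) (j # v)))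
      + (\<Sum>r=1..n. f j r * (nsum f (r - 1) (i # u) * nsum f (r - 1) v))
      + (\<Sum>r=1..n. f i r * f j r * (nsum f (r - 1) u * nsum f (r - 1) v))"
  unfolding nsum.simps
  by (subst sum_mult_sum_split) (simp add: mult_ac)

text \<open>The harmonic product as a list of indices with multiplicity, so that nested sums can be
  treated without the algebra \<open>H\<close>; \<open>harm_harm_list\<close> links it to
  \<open>harm\<close>.\<close>

fun harm_list :: "nat list \<Rightarrow> nat list \<Rightarrow> nat list list" where
  "harm_list [] v = [v]"
| "harm_list u [] = [u]"
| "harm_list (i # u) (j # v) = map ((#) i) (harm_list u (j # v))
      @ map ((#) j) (harm_list (i # u) v) @ map ((#) (i + j)) (harm_list u v)"

text \<open>The three regions of the double sum match the three branches of
  \<open>harm_list\<close>; on the diagonal, multiplicativity merges the two summands into one with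
  exponent i + j.\<close>

lemma nsum_harm_list:
  assumes "\<And>i j r. f (i + j) r = f i r * f j r"
  shows "(\<Sum>ks\<leftarrow>harm_list u v. nsum f n ks) = nsum f n u * nsum f n v"
proof (induction u v arbitrary: n rule: harm_list.induct)
  case (3 i u j v)
  have swap: "(\<Sum>ks\<leftarrow>L. \<Sum>r=1..n. f k r * nsum f (r - 1) ks)
      = (\<Sum>r=1..n. f k r * (\<Sum>ks\<leftarrow>L. nsum f (r - 1) ks))" for k L
    by (induction L) (simp_all add: sum.distrib distrib_left)
  show ?case
    by (subst nsum_Cons_mult_Cons)
       (simp add: o_def swap[unfolded One_nat_def] 3 assms[symmetric] del: nsum.simps(2)
         add: nsum.simps(2)[of f n])
qed simp_all

section \<open>The \<open>q\<close>-Newton expansion\<close>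

definition iq :: "nat \<Rightarrow> rat fps" where "iq m = inverse (qint m)"

section \<open>q-integers and their inverses\<close>

lemma qint_Suc: "qint (Suc n) = qint n + fps_X ^ n"
  by (simp add: qint_def)

lemma qint_Suc': "qint (Suc n) = 1 + fps_X * qint n"
  by (simp only: qint_def sum.lessThan_Suc_shift) (simp add: sum_distrib_left)

lemma qint_mult: "(1 - fps_X) * qint n = 1 - fps_X ^ n"
proof (induction n)
  case 0
  show ?case by (simp add: qint_def)
next
  case (Suc n)
  have "(1 - fps_X) * qint (Suc n) = (1 - fps_X) * qint n + (1 - fps_X) * fps_X ^ n"
    by (simp add: qint_Suc distrib_left)
  then show ?case unfolding Suc.IH by (simp add: left_diff_distrib)
qed

lemma qint_iq: "m \<ge> 1 \<Longrightarrow> qint m * iq m = 1"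
proof -
  assume "m \<ge> 1"
  then have "fps_nth (qint m) 0 \<noteq> 0"
    by (cases m) (simp_all add: qint_Suc')
  then show ?thesis by (simp add: iq_def inverse_mult_eq_1')
qed

text \<open>The Newton product of the factors 1 + T/[i] at T = -[n].\<close>

definition Ek :: "nat \<Rightarrow> nat \<Rightarrow> rat fps" where
  "Ek n m = (\<Prod>i=1..m. 1 - qint n * iq i)"

text \<open>The coefficient of \<open>dual_term w m\<close> in the Newton series at \<open>T = -[n]\<close>; \<open>Dk\<close> is its
  difference in \<open>n\<close>.\<close>
definition Kk :: "nat \<Rightarrow> nat \<Rightarrow> rat fps" where
  "Kk n m = (if m = 0 then 1 else - (fps_X ^ m * qint n * iq m * Ek n (m - 1)))"

section \<open>Recurrences and vanishing of the Newton kernels\<close>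

lemma Ek_Suc: "Ek n (Suc m) = Ek n m * (1 - qint n * iq (Suc m))"
  by (simp add: Ek_def)

text \<open>The factor i = n is zero; this makes the Newton series finite at T = -[n].\<close>

lemma Ek_eq_0: "1 \<le> n \<Longrightarrow> n \<le> m \<Longrightarrow> Ek n m = 0"
  unfolding Ek_def using qint_iq[of n] by (intro prod_zero) auto

text \<open>Since [n+1] = 1 + q[n], the factor 1 - [n+1]/[i] equals q([i-1] - [n])/[i]. Shifting the
  denominators by one position turns these factors into those of \<open>Ek n\<close> up to m - 1,
  with q^m and -[n]/[m] left over.\<close>

lemma Ek_Suc_left: "Ek (Suc n) m = Kk n m"
proof (induction m)
  case 0 then show ?case by (simp add: Ek_def Kk_def)
next
  case (Suc m)
  have q: "1 - qint (Suc n) * iq (Suc m) = fps_X * (qint m - qint n) * iq (Suc m)"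
  proof -
    have "1 - qint (Suc n) * iq (Suc m) = (qint (Suc m) - qint (Suc n)) * iq (Suc m)"
      using qint_iq[of "Suc m"] by (simp add: algebra_simps)
    then show ?thesis by (simp add: qint_Suc' algebra_simps)
  qed
  show ?case
  proof (cases m)
    case 0
    then show ?thesis using q by (simp add: Ek_def Kk_def) (simp add: qint_def)
  next
    case (Suc l)
    have "(qint m - qint n) * iq m = 1 - qint n * iq m"
      using qint_iq[of m] Suc by (simp add: algebra_simps)
    then have e: "Ek n m = Ek n l * ((qint m - qint n) * iq m)" by (simp add: Suc Ek_Suc)
    have "Ek (Suc n) (Suc m) = - (fps_X ^ m * qint n * iq m * Ek n l)
        * (fps_X * (qint m - qint n) * iq (Suc m))"
      unfolding Ek_Suc[of "Suc n"] q Suc.IH by (simp add: Kk_def Suc)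
    also have "\<dots> = - (fps_X ^ Suc m * qint n * iq (Suc m) * Ek n m)"
      by (simp add: e algebra_simps)
    finally show ?thesis by (simp add: Kk_def)
  qed
qed

definition Dk :: "nat \<Rightarrow> nat \<Rightarrow> rat fps" where
  "Dk n m = - (fps_X ^ n * Ek n (m - 1))"

text \<open>As \<open>Kk n m\<close> equals \<open>Ek (Suc n) m\<close>, both terms share the factor
  \<open>Ek (Suc n) (m - 1)\<close>; the cofactor collapses by (1 - q)[m] = 1 - q^m.\<close>

lemma Kk_diff:
  assumes "m \<ge> 1"
  shows "Kk (Suc n) m - Kk n m = Dk (Suc n) m"
proof -
  obtain l where m: "m = Suc l" using assms by (cases m) auto
  let ?Q = "qint (Suc n)"
  have a: "?Q * iq m * (1 - fps_X ^ m) = ?Q * (1 - fps_X)"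
  proof -
    have "?Q * iq m * (1 - fps_X ^ m) = ?Q * (1 - fps_X) * (qint m * iq m)"
      unfolding qint_mult[of m, symmetric] by (simp add: mult_ac)
    then show ?thesis using qint_iq[OF assms] by simp
  qed
  have b: "?Q * (1 - fps_X) = 1 - fps_X ^ Suc n"
    using qint_mult[of "Suc n"] by (simp add: mult.commute)
  have "Kk (Suc n) m - Kk n m = Kk (Suc n) m - Ek (Suc n) m"
    by (simp add: Ek_Suc_left)
  also have "\<dots> = Ek (Suc n) l * (?Q * iq m * (1 - fps_X ^ m) - 1)"
    by (simp add: m Kk_def Ek_Suc algebra_simps)
  also have "\<dots> = Dk (Suc n) m"
    unfolding a b by (simp add: Dk_def m algebra_simps)
  finally show ?thesis .
qed

lemma Kk_eq_sum_Dk: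
  assumes "m \<ge> 1" shows "Kk n m = (\<Sum>r=1..n. Dk r m)"
proof (induction n)
  case 0 then show ?case using assms by (simp add: Kk_def qint_def)
next
  case (Suc n) then show ?case using Kk_diff[OF assms, of n] by (simp add: algebra_simps)
qed

lemma Dk_Suc_right: "1 \<le> n \<Longrightarrow> Dk n (Suc m) = - (fps_X ^ n * Kk (n - 1) m)"
  using Ek_Suc_left[of "n - 1" m] by (simp add: Dk_def)

lemma Dk_eq_0: "1 \<le> n \<Longrightarrow> n < m \<Longrightarrow> Dk n m = 0"
  by (simp add: Dk_def Ek_eq_0)

lemma Kk_eq_0: "n < m \<Longrightarrow> Kk n m = 0"
  using Ek_Suc_left[of n m] by (simp add: Ek_eq_0)

text \<open>Passing from m to m + 1 multiplies \<open>Dk n m\<close> by 1 - [n]/[m]. Hence division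
  by [m] amounts to a difference in m divided by [n], and sums over m telescope.\<close>

lemma Dk_iq: "1 \<le> n \<Longrightarrow> 1 \<le> m \<Longrightarrow> Dk n m * iq m = (Dk n m - Dk n (Suc m)) * iq n"
proof -
  assume n: "1 \<le> n" and m: "1 \<le> m"
  have "Dk n (Suc m) = Dk n m * (1 - qint n * iq m)"
    using m Ek_Suc[of n "m - 1"] by (simp add: Dk_def)
  then have "(Dk n m - Dk n (Suc m)) * iq n = Dk n m * iq m * (qint n * iq n)"
    by (simp only:) (simp add: algebra_simps)
  then show ?thesis using qint_iq[OF n] by simp
qed

lemma sum_Dk_iq:
  assumes "1 \<le> n" "r \<le> n"
  shows "(\<Sum>m=Suc r..n. Dk n m * iq m) = Dk n (Suc r) * iq n"
proof -
  have "(\<Sum>m=Suc r..n. Dk n m * iq m) = (\<Sum>m=Suc r..n. Dk n m - Dk n (Suc m)) * iq n"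
    unfolding sum_distrib_right using assms by (intro sum.cong) (auto simp: Dk_iq)
  also have "(\<Sum>m=Suc r..n. Dk n m - Dk n (Suc m)) = Dk n (Suc r) - Dk n (Suc n)"
    using sum_Suc_diff[of "Suc r" n "\<lambda>m. - Dk n m"] assms by simp
  also have "Dk n (Suc n) = 0" using assms by (simp add: Dk_eq_0)
  finally show ?thesis by simp
qed

text \<open>\<open>dual_term w m\<close> is the value at \<open>m\<close> of \<open>nterm\<close> on \<open>\<phi>(w)\<close>, for the summand
  \<open>q^((k-1)r) / [r]^k\<close>; see \<open>wext_nterm_phiw\<close>.\<close>
fun dual_term :: "letter list \<Rightarrow> nat \<Rightarrow> rat fps" where
  "dual_term [] m = 0"
| "dual_term (X # w) m = iq m * (fps_X ^ m * dual_term w m + (\<Sum>r=1..m-1. dual_term w r))"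
| "dual_term (Y # w) m = - (iq m * (if w = [] then 1 else \<Sum>r=1..m-1. dual_term w r))"

definition good :: "letter list \<Rightarrow> bool" where
  "good u \<longleftrightarrow> u \<noteq> [] \<and> last u = Y"

lemma good_simps [simp]:
  "\<not> good []" "good (X # w) \<longleftrightarrow> good w" "good (Y # w) \<longleftrightarrow> w = [] \<or> good w"
  by (auto simp: good_def)

lemma good_induct [consumes 1, case_names Y_Nil X_Cons Y_Cons]:
  assumes "good u" "P [Y]" "\<And>w. good w \<Longrightarrow> P w \<Longrightarrow> P (X # w)" "\<And>w. good w \<Longrightarrow> P w \<Longrightarrow> P (Y # w)"
  shows "P u"
  using assms(1)
proof (induction u)
  case (Cons a u)
  then show ?case using assms(2-) by (cases a) auto
qed simp

lemma ind_good: "good u \<Longrightarrow> \<exists>k ks. ind u = k # ks"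
  by (induction rule: good_induct) auto

lemma ind_ne_Nil: "good u \<Longrightarrow> ind u \<noteq> []"
  using ind_good by fastforce

lemma ind_pos: "k \<in> set (ind u) \<Longrightarrow> 1 \<le> k"
proof (induction u arbitrary: k rule: ind.induct)
  case (3 w)
  then show ?case by (cases "ind w") auto
qed auto

text \<open>Unlike the summand q^((k-1)r)/[r]^k of \<open>zq\<close>, this one is multiplicative in
  k, so its nested sums obey the plain harmonic product.\<close>

definition geo :: "nat \<Rightarrow> nat \<Rightarrow> rat fps" where
  "geo k r = (fps_X ^ r * iq r) ^ k"

section \<open>Duality for finite nested sums\<close>

lemma sum_sum_less_swap:
  fixes f :: "nat \<Rightarrow> 'a::comm_ring_1"
  shows "(\<Sum>m=1..n. f m * (\<Sum>r=1..m-1. b r)) = (\<Sum>r=1..n. (\<Sum>m=Suc r..n. f m) * b r)"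
proof (induction n)
  case (Suc n)
  have "(\<Sum>r=1..n. (\<Sum>m=Suc r..Suc n. f m) * b r) = (\<Sum>r=1..n. (\<Sum>m=Suc r..n. f m) * b r + f (Suc n) * b r)"
    by (intro sum.cong) (auto simp: algebra_simps)
  then show ?case using Suc by (simp add: sum.distrib sum_distrib_left)
qed simp

text \<open>Summation over the outer variable turns the kernel \<open>Dk\<close> into
  \<open>Kk\<close>. The inner limit r may be raised to n because \<open>Dk r m\<close> vanishes for
  m > r.\<close>

lemma sum_Kk_eq:
  assumes "\<And>r. 1 \<le> r \<Longrightarrow> r \<le> n \<Longrightarrow> a r = (\<Sum>m=1..r. Dk r m * b m)"
  shows "(\<Sum>r=1..n. a r) = (\<Sum>m=1..n. Kk n m * b m)"
proof -
  have "(\<Sum>r=1..n. a r) = (\<Sum>r=1..n. \<Sum>m=1..n. Dk r m * b m)"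
  proof (intro sum.cong refl)
    fix r assume r: "r \<in> {1..n}"
    show "a r = (\<Sum>m=1..n. Dk r m * b m)"
      using r by (subst assms) (auto intro!: sum.mono_neutral_left simp: Dk_eq_0)
  qed
  also have "\<dots> = (\<Sum>m=1..n. (\<Sum>r=1..n. Dk r m) * b m)"
    by (subst sum.swap) (simp add: sum_distrib_right)
  also have "\<dots> = (\<Sum>m=1..n. Kk n m * b m)"
    by (intro sum.cong) (auto simp: Kk_eq_sum_Dk)
  finally show ?thesis .
qed

text \<open>Both (1 - q^n)/[n] and (1 - q^r)/[r] equal 1 - q, so the two differences 1/[n] - q^n/[n]
  and 1/[r] - q^r/[r] coincide.\<close>

lemma Dk_x_step:
  assumes "1 \<le> n" "1 \<le> r"
  shows "fps_X ^ r * Dk n r * iq r + Dk n (Suc r) * iq n = fps_X ^ n * iq n * Dk n r"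
proof -
  have D: "Dk n (Suc r) * iq n = Dk n r * iq n - Dk n r * iq r"
    using Dk_iq[OF assms] by (simp add: algebra_simps)
  have r: "(1 - fps_X) = (1 - fps_X ^ r) * iq r"
    using qint_iq[OF assms(2)] unfolding qint_mult[symmetric] by (simp add: mult.assoc)
  have n: "(1 - fps_X) = (1 - fps_X ^ n) * iq n"
    using qint_iq[OF assms(1)] unfolding qint_mult[symmetric] by (simp add: mult.assoc)
  have "iq n - fps_X ^ n * iq n = iq r - fps_X ^ r * iq r"
    using r n by (simp add: algebra_simps)
  then have "Dk n r * (iq n - fps_X ^ n * iq n) = Dk n r * (iq r - fps_X ^ r * iq r)" by simp
  then show ?thesis unfolding D by (simp add: algebra_simps)
qed

lemma nterm_geo_X: "good w \<Longrightarrow> nterm geo n (ind (X # w)) = fps_X ^ n * iq n * nterm geo n (ind w)"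
  using ind_good[of w] by (auto simp: geo_def mult_ac)

lemma nterm_geo_Y: "nterm geo n (ind (Y # w)) = fps_X ^ n * iq n * nsum geo (n - 1) (ind w)"
  by (auto simp: geo_def mult_ac)

text \<open>The q-analogue of Hoffman duality: the transform with kernel \<open>Dk\<close> carries
  the prefix rules of \<open>dual_term\<close> to those of the \<open>geo\<close> terms. A prefix x
  is handled by \<open>Dk_x_step\<close>, a prefix y by \<open>Dk_Suc_right\<close> and the summed
  induction hypothesis.\<close>

lemma nterm_geo_dual:
  assumes "good w" "1 \<le> n"
  shows "nterm geo n (ind w) = (\<Sum>m=1..n. Dk n m * dual_term w m)"
  using assms
proof (induction w arbitrary: n rule: good_induct)
  case (Y_Nil n)
  \<comment> \<open>This minus sign cancels the one in \<open>dual_term [Y]\<close>.\<close>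
  have "Dk n (Suc 0) = - (fps_X ^ n)" by (simp add: Dk_def Ek_def)
  then show ?case using sum_Dk_iq[of n 0] Y_Nil
    by (simp add: geo_def sum_negf)
next
  case (X_Cons w)
  have "(\<Sum>m=1..n. Dk n m * dual_term (X # w) m)
      = (\<Sum>m=1..n. fps_X ^ m * Dk n m * iq m * dual_term w m)
        + (\<Sum>m=1..n. (Dk n m * iq m) * (\<Sum>r=1..m-1. dual_term w r))"
    by (simp add: sum.distrib[symmetric] algebra_simps)
  \<comment> \<open>After the interchange, \<open>dual_term w r\<close> carries a diagonal part and
    a tail over m > r, which telescopes by \<open>sum_Dk_iq\<close>.\<close>
  also have "\<dots> = (\<Sum>r=1..n. (fps_X ^ r * Dk n r * iq r + Dk n (Suc r) * iq n) * dual_term w r)"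
    unfolding sum_sum_less_swap sum.distrib[symmetric]
  proof (intro sum.cong refl)
    fix r assume "r \<in> {1..n}"
    then show "fps_X ^ r * Dk n r * iq r * dual_term w r
        + (\<Sum>m=Suc r..n. Dk n m * iq m) * dual_term w r
      = (fps_X ^ r * Dk n r * iq r + Dk n (Suc r) * iq n) * dual_term w r"
      using sum_Dk_iq[OF X_Cons.prems, of r] by (simp only: atLeastAtMost_iff distrib_right)
  qed
  also have "\<dots> = (\<Sum>r=1..n. fps_X ^ n * iq n * (Dk n r * dual_term w r))"
    using X_Cons.prems
    by (intro sum.cong refl) (simp only: Dk_x_step atLeastAtMost_iff mult.assoc[symmetric])
  finally show ?case unfolding nterm_geo_X[OF X_Cons.hyps] X_Cons.IH[OF X_Cons.prems]
    by (simp add: sum_distrib_left)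
next
  case (Y_Cons w)
  have w: "w \<noteq> []" using Y_Cons.hyps by auto
  have "(\<Sum>m=1..n. Dk n m * dual_term (Y # w) m)
      = - (\<Sum>m=1..n. (Dk n m * iq m) * (\<Sum>r=1..m-1. dual_term w r))"
    using w by (simp add: sum_negf mult.assoc)
  also have "\<dots> = - (\<Sum>r=1..n. (Dk n (Suc r) * iq n) * dual_term w r)"
    unfolding sum_sum_less_swap neg_equal_iff_equal using Y_Cons.prems
    by (intro sum.cong refl) (simp add: sum_Dk_iq[unfolded atLeastAtMost_iff])
  also have "\<dots> = (\<Sum>r=1..n. fps_X ^ n * iq n * (Kk (n - 1) r * dual_term w r))"
    unfolding sum_negf[symmetric] using Y_Cons.prems
    by (intro sum.cong refl) (simp add: Dk_Suc_right mult_ac)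
  \<comment> \<open>\<open>Kk (n - 1) n\<close> is zero, so the sum ends at n - 1, the range over
    which the induction hypothesis is summed.\<close>
  also have "\<dots> = (\<Sum>r=1..n-1. fps_X ^ n * iq n * (Kk (n - 1) r * dual_term w r))"
    by (intro sum.mono_neutral_right) (auto simp: Kk_eq_0)
  also have "\<dots> = fps_X ^ n * iq n * nsum geo (n - 1) (ind w)"
    using sum_Kk_eq[of "n - 1" "\<lambda>r. nterm geo r (ind w)" "dual_term w"] Y_Cons
    by (simp add: nsum_nterm ind_ne_Nil sum_distrib_left)
  finally show ?case unfolding nterm_geo_Y by simp
qed

lemma nsum_geo_dual:
  assumes "good w"
  shows "nsum geo n (ind w) = (\<Sum>m=1..n. Kk n m * dual_term w m)"
  unfolding nsum_nterm[OF ind_ne_Nil[OF assms]]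
  by (rule sum_Kk_eq) (auto simp: nterm_geo_dual assms)

text \<open>The Newton series F_w(T) cut off at m = M, as a polynomial in T; \<open>pCons 0\<close>
  supplies the factor T.\<close>

definition Kpoly :: "nat \<Rightarrow> letter list \<Rightarrow> rat fps poly" where
  "Kpoly M w = (\<Sum>m=1..M. smult (fps_X ^ m * dual_term w m * iq m)
      (pCons 0 (\<Prod>r=1..m-1. [:1, iq r:])))"

text \<open>At T = -[n] all terms with m > n vanish, so the cut-off loses nothing once n \<le>
  M.\<close>

lemma poly_Kpoly:
  assumes "good w" "n \<le> M"
  shows "poly (Kpoly M w) (- qint n) = nsum geo n (ind w)"
proof -
  have "poly (Kpoly M w) (- qint n) = (\<Sum>m=1..M. Kk n m * dual_term w m)"
    by (simp add: Kpoly_def poly_sum poly_prod Kk_def Ek_def mult_ac)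
  also have "\<dots> = (\<Sum>m=1..n. Kk n m * dual_term w m)"
    using assms by (intro sum.mono_neutral_right) (auto simp: Kk_eq_0)
  finally show ?thesis by (simp add: nsum_geo_dual assms)
qed

section \<open>Uniqueness of the expansion\<close>

text \<open>Divisibility by \<open>fps_X ^ M\<close> expresses agreement below q^M and takes the
  place of limits.\<close>

lemma X_power_dvd_fps_iff:
  fixes a :: "rat fps"
  shows "fps_X ^ M dvd a \<longleftrightarrow> (\<forall>N<M. fps_nth a N = 0)"
proof
  assume "fps_X ^ M dvd a"
  then show "\<forall>N<M. fps_nth a N = 0" by (auto simp: dvd_def fps_X_power_mult_nth)
next
  assume "\<forall>N<M. fps_nth a N = 0"
  then have "a = fps_X ^ M * fps_shift M a"
    by (auto simp: fps_eq_iff fps_X_power_mult_nth)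
  then show "fps_X ^ M dvd a" by (rule dvdI)
qed

text \<open>A power series in \<open>u\<close> over \<open>\<rat>[[q]]\<close> vanishing at \<open>u = q^n\<close> for all \<open>n\<close> is zero: for the
  coefficient of \<open>q^N u^k\<close> take \<open>n = N + 1\<close> and compare the coefficients of \<open>q^(N + n k)\<close>.\<close>
lemma coeffs_vanish:
  fixes G :: "nat \<Rightarrow> rat fps poly"
  assumes stable: "\<And>M M'. M \<le> M' \<Longrightarrow> [:fps_X ^ M:] dvd G M' - G M"
    and vanish: "\<And>n M. 1 \<le> n \<Longrightarrow> n \<le> M \<Longrightarrow> poly (G M) (fps_X ^ n) = 0"
  shows "[:fps_X ^ M:] dvd G M"
proof -
  \<comment> \<open>The coefficient of q^N is the same in all \<open>G M\<close> with M > N, so the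
    family stands for a single series in u.\<close>
  have stab: "fps_nth (coeff (G M') k) N = fps_nth (coeff (G M) k) N" if "N < M" "M \<le> M'" for M M' N k
    using stable[OF that(2)] that(1) by (auto simp: const_poly_dvd_iff X_power_dvd_fps_iff)
  have "\<forall>N M. N < M \<longrightarrow> fps_nth (coeff (G M) k) N = 0" for k
  proof (induction k rule: less_induct)
    case (less k)
    show ?case
    proof (intro allI impI)
      fix N M :: nat assume "N < M"
      \<comment> \<open>With n = N + 1, powers u^j with j > k start beyond q^(N + n k) after u =
        q^n.\<close>
      define n where "n = Suc N"
      \<comment> \<open>Large enough for \<open>vanish\<close> at n and for the induction hypothesis
        at every exponent that powers u^j with j < k contribute.\<close>
      define M' where "M' = M + n + n * k"
      have "poly (G M') (fps_X ^ n) = 0" using vanish[of n M'] by (simp add: n_def M'_def)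
      then have "(\<Sum>j\<le>degree (G M'). fps_nth (coeff (G M') j * fps_X ^ (n * j)) (N + n * k)) = 0"
        by (simp add: poly_altdef power_mult[symmetric] fps_sum_nth[symmetric])
      moreover have "fps_nth (coeff (G M') j * fps_X ^ (n * j)) (N + n * k)
          = (if j = k then fps_nth (coeff (G M') k) N else 0)" for j
      proof -
        consider "j < k" | "j = k" | "j > k" by linarith
        then show ?thesis
        proof cases
          case 1
          then have "n * j \<le> n * k" by simp
          moreover have "N + n * k - n * j < M'" using \<open>N < M\<close> by (simp add: M'_def)
          ultimately show ?thesis using 1 less by (auto simp: fps_X_power_mult_right_nth)
        next
          case 2 then show ?thesis by (auto simp: fps_X_power_mult_right_nth)
        next
          case 3
          then have "n * Suc k \<le> n * j" by (intro mult_le_mono) auto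
          then have "N + n * k < n * j" by (simp add: n_def)
          then show ?thesis using 3 by (auto simp: fps_X_power_mult_right_nth)
        qed
      qed
      ultimately have "fps_nth (coeff (G M') k) N = 0 \<or> k > degree (G M')"
        by (auto simp: sum.delta split: if_splits)
      then have "fps_nth (coeff (G M') k) N = 0" by (auto simp: coeff_eq_0)
      then show "fps_nth (coeff (G M) k) N = 0" using stab[OF \<open>N < M\<close>, of M' k] by (simp add: M'_def)
    qed
  qed
  then show ?thesis by (auto simp: const_poly_dvd_iff X_power_dvd_fps_iff)
qed

lemma const_dvd_pcompose: "[:a:] dvd p \<Longrightarrow> [:a:] dvd pcompose p (r :: rat fps poly)"
  by (auto simp: dvd_def pcompose_smult)

text \<open>Each additional summand has a factor q^m with m > M.\<close>

lemma Kpoly_stable: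
  assumes "M \<le> M'"
  shows "[:fps_X ^ M:] dvd Kpoly M' w - Kpoly M w"
proof -
  have "Kpoly M' w - Kpoly M w = (\<Sum>m\<in>{1..M'} - {1..M}. smult (fps_X ^ m * dual_term w m * iq m)
      (pCons 0 (\<Prod>r=1..m-1. [:1, iq r:])))"
    unfolding Kpoly_def using assms by (subst sum_diff) auto
  moreover have "[:fps_X ^ M:] dvd smult (fps_X ^ m * dual_term w m * iq m) p"
    if "m \<in> {1..M'} - {1..M}" for m and p :: "rat fps poly"
  proof -
    have "fps_X ^ M dvd (fps_X :: rat fps) ^ m" using that by (intro le_imp_power_dvd) auto
    then show ?thesis by (auto simp: const_poly_dvd_iff)
  qed
  ultimately show ?thesis by (simp only: dvd_sum)
qed

section \<open>Words, index lists and the product of Newton series\<close>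

lemma zw_good: "\<forall>k\<in>set ks. 1 \<le> k \<Longrightarrow> ks \<noteq> [] \<Longrightarrow> good (zw ks)"
  by (induction ks rule: rev_induct) (auto simp: good_def zw_def z_def)

text \<open>Positivity matters: \<open>z 0\<close> coincides with \<open>z 1\<close>, since
  \<open>k - 1\<close> is truncated.\<close>

lemma ind_z_append: "1 \<le> k \<Longrightarrow> ind (z k @ u) = k # ind u"
proof -
  have "ind (replicate l X @ Y # u) = Suc l # ind u" for l
    by (induction l) auto
  then show "1 \<le> k \<Longrightarrow> ?thesis" by (simp add: z_def)
qed

lemma ind_zw: "\<forall>k\<in>set ks. 1 \<le> k \<Longrightarrow> ind (zw ks) = ks"
  by (induction ks) (auto simp: zw_def ind_z_append)

lemma harm_list_pos:
  "\<lbrakk>\<forall>k\<in>set u. 1 \<le> k; \<forall>k\<in>set v. 1 \<le> k; ks \<in> set (harm_list u v); k \<in> set ks\<rbrakk> \<Longrightarrow> 1 \<le> k"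
proof (induction u v arbitrary: ks k rule: harm_list.induct)
  case (3 i u j v)
  from 3(6) obtain l ls where ks: "ks = l # ls" and l: "1 \<le> l"
    and ls: "ls \<in> set (harm_list u (j # v)) \<or> ls \<in> set (harm_list (i # u) v)
      \<or> ls \<in> set (harm_list u v)"
    using 3(4,5) by auto
  have "1 \<le> k'" if "k' \<in> set ls" for k'
    using ls 3(1-3)[of ls k'] 3(4,5) that by auto
  then show ?case using 3(7) ks l by auto
qed auto

lemma harm_list_ne_Nil: "ks \<in> set (harm_list u v) \<Longrightarrow> u \<noteq> [] \<Longrightarrow> ks \<noteq> []"
  by (induction u v arbitrary: ks rule: harm_list.induct) auto

lemma poly_sum_list: "poly (\<Sum>x\<leftarrow>xs. f x) p = (\<Sum>x\<leftarrow>xs. poly (f x) p)"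
  by (induction xs) simp_all

text \<open>Both sides agree at T = -[n] for n \<le> M, because the \<open>geo\<close> sums are
  multiplicative for \<open>harm_list\<close>; \<open>coeffs_vanish\<close> applies after a linear
  change of variable that moves these points to u = q^n.\<close>

lemma Kpoly_mult:
  assumes "good v" "good w"
  shows "[:fps_X ^ M:] dvd Kpoly M v * Kpoly M w
    - (\<Sum>ks\<leftarrow>harm_list (ind v) (ind w). Kpoly M (zw ks))"
proof -
  define G where "G M = Kpoly M v * Kpoly M w
    - (\<Sum>ks\<leftarrow>harm_list (ind v) (ind w). Kpoly M (zw ks))" for M
  \<comment> \<open>With e = 1/(1 - q), the polynomial \<open>[:- e, e:]\<close> is the substitution
    T = (u - 1)/(1 - q).\<close>
  define e :: "rat fps" where "e = inverse (1 - fps_X)"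
  have e: "(1 - fps_X) * e = 1" unfolding e_def by (rule inverse_mult_eq_1') simp
  have "[:fps_X ^ M:] dvd pcompose (G M) [:- e, e:]"
  proof (rule coeffs_vanish)
    fix M M' :: nat assume le: "M \<le> M'"
    have a: "[:fps_X ^ M:] dvd Kpoly M' v * Kpoly M' w - Kpoly M v * Kpoly M w"
    proof -
      have "Kpoly M' v * Kpoly M' w - Kpoly M v * Kpoly M w
        = Kpoly M' v * (Kpoly M' w - Kpoly M w) + (Kpoly M' v - Kpoly M v) * Kpoly M w"
        by (simp add: algebra_simps)
      then show ?thesis using Kpoly_stable[OF le] by simp
    qed
    have b: "[:fps_X ^ M:] dvd (\<Sum>ks\<leftarrow>L. Kpoly M' (zw ks)) - (\<Sum>ks\<leftarrow>L. Kpoly M (zw ks))" for L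
    proof (induction L)
      case (Cons k L)
      from dvd_add[OF Kpoly_stable[OF le, of "zw k"] Cons] show ?case by (simp add: algebra_simps)
    qed simp
    have "[:fps_X ^ M:] dvd G M' - G M"
      using dvd_diff[OF a b[of "harm_list (ind v) (ind w)"]]
      by (simp add: G_def algebra_simps)
    then show "[:fps_X ^ M:] dvd pcompose (G M') [:- e, e:] - pcompose (G M) [:- e, e:]"
      unfolding pcompose_diff[symmetric] by (rule const_dvd_pcompose)
  next
    fix n M :: nat assume n: "1 \<le> n" "n \<le> M"
    have "poly [:- e, e:] (fps_X ^ n) = - (e * (1 - fps_X ^ n))" by (simp add: algebra_simps)
    also have "\<dots> = - qint n" using e unfolding qint_mult[symmetric]
      by (simp add: mult.assoc[symmetric] mult.commute)
    finally have p: "poly [:- e, e:] (fps_X ^ n) = - qint n" .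
    have "(\<Sum>ks\<leftarrow>harm_list (ind v) (ind w). poly (Kpoly M (zw ks)) (- qint n))
        = (\<Sum>ks\<leftarrow>harm_list (ind v) (ind w). nsum geo n ks)"
    proof (intro arg_cong[where f = sum_list] map_cong refl)
      fix ks assume ks: "ks \<in> set (harm_list (ind v) (ind w))"
      have pos: "\<forall>k\<in>set ks. 1 \<le> k" using harm_list_pos[OF _ _ ks] ind_pos by blast
      have "ks \<noteq> []" using harm_list_ne_Nil[OF ks] ind_ne_Nil[OF assms(1)] by blast
      then show "poly (Kpoly M (zw ks)) (- qint n) = nsum geo n ks"
        using poly_Kpoly[OF zw_good[OF pos] n(2)] ind_zw[OF pos] by simp
    qed
    also have "\<dots> = nsum geo n (ind v) * nsum geo n (ind w)"
      by (rule nsum_harm_list) (simp add: geo_def power_add)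
    finally show "poly (pcompose (G M) [:- e, e:]) (fps_X ^ n) = 0"
      unfolding poly_pcompose p G_def using assms n
      by (simp add: poly_Kpoly poly_sum_list)
  qed
  \<comment> \<open>The inverse substitution u = 1 + (1 - q)T returns to the variable T.\<close>
  then have "[:fps_X ^ M:] dvd pcompose (pcompose (G M) [:- e, e:]) [:1, 1 - fps_X:]"
    by (rule const_dvd_pcompose)
  moreover have "pcompose [:- e, e:] [:1, 1 - fps_X:] = [:0, 1:]"
    using e by (simp add: pcompose_pCons algebra_simps)
  ultimately have "[:fps_X ^ M:] dvd G M"
    by (simp add: pcompose_assoc[symmetric] pcompose_idR)
  then show ?thesis by (simp add: G_def)
qed

section \<open>Linear extensions of functions on words\<close>

abbreviation "keys \<equiv> Poly_Mapping.keys"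
abbreviation "lookup \<equiv> Poly_Mapping.lookup"

lemma lookup_smultH [simp]: "lookup (smultH c P) u = c * lookup P u"
  by (simp add: smultH_def Poly_Mapping.map.rep_eq when_def)

lemma keys_smultH: "keys (smultH c P) \<subseteq> keys P"
  by (auto simp: in_keys_iff)

lemma single_eq_smultH: "Poly_Mapping.single u c = smultH c (monoH u)"
  by (rule poly_mapping_eqI) (simp add: monoH_def lookup_single when_def)

text \<open>Linear extension from words is needed with two targets: \<open>H\<close> itself, and
  Q[[q]][t] with hbar acting as 1 - q through \<open>fsub\<close>.\<close>

locale coef_module = module scale for scale :: "coef \<Rightarrow> 'b::ab_group_add \<Rightarrow> 'b"
begin

definition lext :: "(letter list \<Rightarrow> 'b) \<Rightarrow> H \<Rightarrow> 'b" where
  "lext g P = (\<Sum>u\<in>keys P. scale (lookup P u) (g u))"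

lemma lext_superset:
  assumes "finite A" "keys P \<subseteq> A"
  shows "lext g P = (\<Sum>u\<in>A. scale (lookup P u) (g u))"
  unfolding lext_def using assms by (intro sum.mono_neutral_left) (auto simp: in_keys_iff)

lemma lext_zero [simp]: "lext g 0 = 0"
  by (simp add: lext_def)

lemma lext_add: "lext g (P + Q) = lext g P + lext g Q"
proof -
  let ?A = "keys P \<union> keys Q"
  have "lext g (P + Q) = (\<Sum>u\<in>?A. scale (lookup (P + Q) u) (g u))"
    by (rule lext_superset) (simp_all add: keys_add)
  also have "\<dots> = (\<Sum>u\<in>?A. scale (lookup P u) (g u)) + (\<Sum>u\<in>?A. scale (lookup Q u) (g u))"
    by (simp add: lookup_add scale_left_distrib sum.distrib)
  also have "\<dots> = lext g P + lext g Q"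
    by (simp add: lext_superset[of ?A])
  finally show ?thesis .
qed

lemma lext_smultH: "lext g (smultH c P) = scale c (lext g P)"
  by (subst lext_superset[of "keys P"]) (simp_all add: keys_smultH lext_def scale_sum_right)

lemma lext_monoH [simp]: "lext g (monoH u) = g u"
  by (subst lext_superset[of "{u}"]) (simp_all add: monoH_def)

lemma lext_uminus: "lext g (- P) = - lext g P"
  using lext_add[of g P "- P"] by (simp add: eq_neg_iff_add_eq_0 add.commute)

lemma lext_diff: "lext g (P - Q) = lext g P - lext g Q"
  using lext_add[of g P "- Q"] by (simp add: lext_uminus)

lemma lext_sum: "lext g (\<Sum>i\<in>I. P i) = (\<Sum>i\<in>I. lext g (P i))"
  by (induction I rule: infinite_finite_induct) (simp_all add: lext_add)

lemma lext_sum_list: "lext g (\<Sum>i\<leftarrow>I. P i) = (\<Sum>i\<leftarrow>I. lext g (P i))"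
  by (induction I) (simp_all add: lext_add)

lemma lext_cong: "(\<And>u. u \<in> keys P \<Longrightarrow> g u = h u) \<Longrightarrow> lext g P = lext h P"
  by (simp add: lext_def)

lemma lext_fun_zero [simp]: "lext (\<lambda>u. 0) P = 0"
  by (simp add: lext_def)

lemma lext_fun_add: "lext (\<lambda>u. g u + h u) P = lext g P + lext h P"
  by (simp add: lext_def scale_right_distrib sum.distrib)

lemma lext_fun_scale: "lext (\<lambda>u. scale c (g u)) P = scale c (lext g P)"
  by (simp add: lext_def scale_sum_right mult.commute)

lemma lext_fun_sum: "lext (\<lambda>u. \<Sum>i\<in>I. g i u) P = (\<Sum>i\<in>I. lext (g i) P)"
  by (induction I rule: infinite_finite_induct) (simp_all add: lext_fun_add)

end

interpretation Hm: coef_module smultH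
  rewrites "coef_module.lext smultH = linH"
proof -
  show *: "coef_module smultH"
    by unfold_locales (auto intro!: poly_mapping_eqI simp: lookup_add algebra_simps)
  show "coef_module.lext smultH = linH"
    by (intro ext) (simp add: coef_module.lext_def[OF *] linH_def)
qed

context coef_module
begin

lemma lext_linH: "lext g (linH f P) = lext (\<lambda>u. lext g (f u)) P"
  by (simp add: linH_def lext_sum lext_smultH) (simp add: lext_def)

end

lemma linH_monoH [simp]: "linH monoH P = P"
  by (rule poly_mapping_eqI)
     (auto simp: linH_def lookup_sum monoH_def lookup_single when_def in_keys_iff
       if_distrib[of "\<lambda>x. _ * x"] cong: if_cong)

lemma bilinH_linH: "bilinH f P Q = linH (\<lambda>u. linH (\<lambda>v. f u v) Q) P"
  by (simp add: bilinH_def linH_def Hm.scale_sum_right)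

lemma mulH_linH: "mulH P Q = linH (\<lambda>u. linH (\<lambda>v. monoH (u @ v)) Q) P"
  by (simp add: mulH_def linH_def Hm.scale_sum_right single_eq_smultH)

definition lw :: "letter list \<Rightarrow> H \<Rightarrow> H" where
  "lw a P = linH (\<lambda>u. monoH (a @ u)) P"

lemma mulH_monoH_left: "mulH (monoH a) P = lw a P"
  by (simp add: mulH_linH lw_def)

lemma mulH_assoc: "mulH (mulH P Q) R = mulH P (mulH Q R)"
  by (simp add: mulH_linH Hm.lext_linH)

lemma zcons_lw: "zcons k P = lw (z k) P"
  by (simp add: zcons_def mulH_monoH_left)

lemma lw_monoH [simp]: "lw a (monoH u) = monoH (a @ u)"
  by (simp add: lw_def)

lemma lw_add: "lw a (P + Q) = lw a P + lw a Q"
  by (simp add: lw_def Hm.lext_add)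

lemma lw_smultH: "lw a (smultH c P) = smultH c (lw a P)"
  by (simp add: lw_def Hm.lext_smultH)

lemma lw_zero [simp]: "lw a 0 = 0"
  by (simp add: lw_def)

lemma lw_linH: "lw a (linH f P) = linH (\<lambda>u. lw a (f u)) P"
  by (simp add: lw_def Hm.lext_linH)

lemma linH_lw: "linH f (lw a P) = linH (\<lambda>u. f (a @ u)) P"
  by (simp add: lw_def Hm.lext_linH)

lemma lw_lw: "lw a (lw b P) = lw (a @ b) P"
  by (simp add: lw_def Hm.lext_linH)

lemma mulH_add_left: "mulH (P + Q) R = mulH P R + mulH Q R"
  by (simp add: mulH_linH Hm.lext_add)

lemma mulH_uminus_left: "mulH (- P) R = - mulH P R"
  by (simp add: mulH_linH Hm.lext_uminus)

lemma mulH_diff_left: "mulH (P - Q) R = mulH P R - mulH Q R"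
  by (simp add: mulH_linH Hm.lext_diff)

lemma mulH_smultH_left: "mulH (smultH c P) R = smultH c (mulH P R)"
  by (simp add: mulH_linH Hm.lext_smultH)

section \<open>Supports of elements of \<open>H\<close>\<close>

lemma keys_monoH [simp]: "keys (monoH u) = {u}"
  by (simp add: monoH_def)

lemma keys_add_subset: "keys P \<subseteq> A \<Longrightarrow> keys Q \<subseteq> A \<Longrightarrow> keys (P + Q) \<subseteq> A"
  using keys_add[of P Q] by blast

lemma keys_smultH_subset: "keys P \<subseteq> A \<Longrightarrow> keys (smultH c P) \<subseteq> A"
  using keys_smultH by blast

lemma keys_uminus_subset: "keys P \<subseteq> A \<Longrightarrow> keys (- P :: H) \<subseteq> A"
  by (auto simp: in_keys_iff)

lemma keys_diff_subset: "keys P \<subseteq> A \<Longrightarrow> keys Q \<subseteq> A \<Longrightarrow> keys (P - Q :: H) \<subseteq> A"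
  using keys_add_subset[of P A "- Q"] keys_uminus_subset[of Q A] by simp

lemma keys_sum_subset: "(\<And>i. i \<in> I \<Longrightarrow> keys (P i) \<subseteq> A) \<Longrightarrow> keys (\<Sum>i\<in>I. P i :: H) \<subseteq> A"
proof (induction I rule: infinite_finite_induct)
  case (insert i I)
  then show ?case by (simp add: keys_add_subset)
qed simp_all

lemma keys_linH_subset: "(\<And>u. u \<in> keys P \<Longrightarrow> keys (f u) \<subseteq> A) \<Longrightarrow> keys (linH f P) \<subseteq> A"
  unfolding linH_def by (intro keys_sum_subset keys_smultH_subset)

lemma keys_lw: "keys (lw a P) \<subseteq> (@) a ` keys P"
  unfolding lw_def by (intro keys_linH_subset) auto

lemma keys_lw_subset: "(@) a ` keys P \<subseteq> A \<Longrightarrow> keys (lw a P) \<subseteq> A"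
  using keys_lw by blast

lemmas keys_closed = keys_add_subset keys_smultH_subset keys_uminus_subset keys_diff_subset

lemma Hy_iff: "P \<in> Hy \<longleftrightarrow> keys P \<subseteq> {u. good u}"
  by (auto simp: Hy_def good_def)

lemma Hy_H1: "P \<in> Hy \<Longrightarrow> P \<in> H1"
  by (auto simp: Hy_def H1_def)

lemma H1_cases: "P \<in> H1 \<Longrightarrow> u \<in> keys P \<Longrightarrow> u = [] \<or> good u"
  by (auto simp: H1_def good_def)

lemma Hy_cases: "P \<in> Hy \<Longrightarrow> u \<in> keys P \<Longrightarrow> good u"
  by (auto simp: Hy_iff)

section \<open>The map \<open>S\<close> and its inverse\<close>

lemma z_Suc: "1 \<le> k \<Longrightarrow> z (Suc k) = X # z k"
  by (cases k) (simp_all add: z_def)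

lemma zw_Suc: "1 \<le> k \<Longrightarrow> zw (Suc k # ks) = X # zw (k # ks)"
  by (simp add: zw_def z_Suc)

lemma zw_ind: "good u \<Longrightarrow> zw (ind u) = u"
proof (induction rule: good_induct)
  case Y_Nil then show ?case by (simp add: zw_def z_def)
next
  case (X_Cons w)
  obtain k ks where k: "ind w = k # ks" using ind_good X_Cons.hyps by blast
  have "1 \<le> k" using ind_pos[of k w] k by simp
  then show ?case using X_Cons.IH k by (simp add: zw_Suc)
next
  case (Y_Cons w) then show ?case by (simp add: zw_def z_def)
qed

text \<open>On \<open>Hy\<close>, z_1 acts as left multiplication by x + hbar, and raising the index
  prefixes an x (\<open>circw_Suc\<close>). This turns the recursion on indices into one on
  letters.\<close>

lemma circw_1: "good u \<Longrightarrow> circw 1 (ind u) = monoH (X # u) + smultH hb (monoH u)"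
proof -
  assume u: "good u"
  then obtain k ks where k: "ind u = k # ks" using ind_good by blast
  have "1 \<le> k" using ind_pos[of k u] k by simp
  then show ?thesis using zw_ind[OF u] k by (simp add: circw_def zw_Suc)
qed

lemma circw_Suc: "1 \<le> k \<Longrightarrow> circw (Suc k) (ind u) = lw [X] (circw k (ind u))"
proof (cases "ind u")
  case (Cons j ks)
  assume k: "1 \<le> k"
  have "1 \<le> j" using ind_pos[of j u] Cons by simp
  then obtain i where j: "j = Suc i" by (cases j) auto
  show ?thesis using k by (simp add: Cons circw_def j zw_Suc lw_add lw_smultH)
qed (simp add: circw_def)

lemma circH_1: "P \<in> Hy \<Longrightarrow> circH 1 P = lw [X] P + smultH hb P"
proof -
  assume "P \<in> Hy"
  then have "circH 1 P = linH (\<lambda>u. monoH (X # u) + smultH hb (monoH u)) P"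
    unfolding circH_def by (intro Hm.lext_cong) (auto dest: Hy_cases simp: circw_1 simp del: One_nat_def)
  then show ?thesis by (simp add: Hm.lext_fun_add Hm.lext_fun_scale lw_def)
qed

lemma circH_Suc: "1 \<le> k \<Longrightarrow> circH (Suc k) P = lw [X] (circH k P)"
  by (simp add: circH_def circw_Suc lw_linH)

lemma Sw_Hy: "\<forall>k\<in>set ks. 1 \<le> k \<Longrightarrow> ks \<noteq> [] \<Longrightarrow> Sw ks \<in> Hy"
proof (induction ks)
  case (Cons k ks)
  have k: "1 \<le> k" using Cons.prems by simp
  have ks: "u = [] \<or> good u" if "u \<in> keys (Sw ks)" for u
    using that Cons by (cases ks) (auto dest: Hy_cases)
  have gz: "good (z k @ u)" if "u = [] \<or> good u" for u
    using that by (auto simp: good_def z_def)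
  have "keys (zcons k (Sw ks)) \<subseteq> {u. good u}"
    unfolding zcons_lw using ks gz by (intro keys_lw_subset) auto
  moreover have "keys (circw k (ind u)) \<subseteq> {u. good u}" for u
  proof (cases "ind u")
    case (Cons j js)
    have "\<forall>l\<in>set (j # js). 1 \<le> l" using ind_pos[of _ u] Cons by auto
    then show ?thesis using k unfolding circw_def Cons list.case
      by (intro keys_add_subset keys_smultH_subset) (auto intro!: zw_good)
  qed (simp add: circw_def)
  ultimately show ?case
    unfolding Hy_iff Sw.simps circH_def
    by (intro keys_add_subset keys_smultH_subset keys_linH_subset) auto
qed simp

lemma Sw_ind_Hy: "good u \<Longrightarrow> Sw (ind u) \<in> Hy"
  by (intro Sw_Hy) (auto simp: ind_ne_Nil dest: ind_pos)

lemma linH_Hy: "P \<in> Hy \<Longrightarrow> (\<And>u. good u \<Longrightarrow> f u \<in> Hy) \<Longrightarrow> linH f P \<in> Hy"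
  by (auto simp: Hy_iff intro!: keys_linH_subset)

lemma S_Hy: "P \<in> Hy \<Longrightarrow> S P \<in> Hy"
  unfolding S_def by (rule linH_Hy) (simp_all add: Sw_ind_Hy)

lemma lw_Hy: "P \<in> Hy \<Longrightarrow> lw a P \<in> Hy"
  unfolding Hy_iff by (rule keys_lw_subset) (auto simp: good_def)

lemma Sw_X: "good w \<Longrightarrow> Sw (ind (X # w)) = lw [X] (Sw (ind w))"
proof -
  assume w: "good w"
  then obtain k ks where k: "ind w = k # ks" using ind_good by blast
  have "1 \<le> k" using ind_pos[of k w] k by simp
  then show ?thesis using k
    by (simp add: zcons_lw z_Suc lw_add lw_smultH circH_Suc lw_lw)
qed

text \<open>Letter by letter, \<open>S\<close> replaces y by y + t x + hbar t, except for the final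
  y of the word, which stays (\<open>Sw_Y_Nil\<close>).\<close>

lemma Sw_Y: "good w \<Longrightarrow> Sw (ind (Y # w)) = lw [Y] (Sw (ind w))
    + smultH tv (lw [X] (Sw (ind w)) + smultH hb (Sw (ind w)))"
  using circH_1[OF Sw_ind_Hy, of w] by (simp add: zcons_lw z_def)

lemma Sw_Y_Nil: "Sw (ind [Y]) = monoH [Y]"
  by (simp add: zcons_lw z_def circH_def circw_def Hm.scale_zero_right)

lemma S_monoH [simp]: "S (monoH u) = Sw (ind u)"
  by (simp add: S_def)

lemma S_add: "S (P + Q) = S P + S Q"
  by (simp add: S_def Hm.lext_add)

lemma S_smultH: "S (smultH c P) = smultH c (S P)"
  by (simp add: S_def Hm.lext_smultH)

lemma S_diff: "S (P - Q) = S P - S Q"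
  by (simp add: S_def Hm.lext_diff)

lemma S_X: "P \<in> Hy \<Longrightarrow> S (lw [X] P) = lw [X] (S P)"
  unfolding S_def linH_lw lw_linH
  by (intro Hm.lext_cong) (auto dest!: Hy_cases simp: Sw_X simp del: ind.simps)

lemma S_Y:
  assumes "P \<in> Hy"
  shows "S (lw [Y] P) = lw [Y] (S P) + smultH tv (lw [X] (S P) + smultH hb (S P))"
proof -
  have "S (lw [Y] P) = linH (\<lambda>w. lw [Y] (Sw (ind w))
    + smultH tv (lw [X] (Sw (ind w)) + smultH hb (Sw (ind w)))) P"
    unfolding S_def linH_lw
    by (intro Hm.lext_cong) (use assms in \<open>auto dest!: Hy_cases simp: Sw_Y simp del: ind.simps\<close>)
  then show ?thesis
    by (simp add: Hm.lext_fun_add Hm.lext_fun_scale S_def lw_linH)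
qed

lemma mulH_Eel: "mulH Eel P = smultH (- tv) (lw [X] P) + lw [Y] P - smultH (hb * tv) P"
  by (simp add: Eel_def mulH_diff_left mulH_add_left mulH_smultH_left mulH_monoH_left)
     (simp add: lw_def)

text \<open>\<open>Eel\<close> is the preimage of y under the letter rule of \<open>S\<close>: the
  terms in t x and hbar t cancel.\<close>

lemma S_Eel: "P \<in> Hy \<Longrightarrow> S (mulH Eel P) = lw [Y] (S P)"
  unfolding mulH_Eel S_diff S_add S_smultH
  by (simp add: S_X S_Y Hm.scale_right_distrib mult.commute)

text \<open>The inverse of \<open>S\<close> on words: every y but the last becomes
  \<open>Eel\<close>.\<close>

fun Lw :: "letter list \<Rightarrow> H" where
  "Lw [] = monoH []"
| "Lw (X # w) = lw [X] (Lw w)"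
| "Lw (Y # w) = (if w = [] then monoH [Y] else mulH Eel (Lw w))"

definition L :: "H \<Rightarrow> H" where "L P = linH Lw P"

lemma mulH_Eel_Hy: "P \<in> Hy \<Longrightarrow> mulH Eel P \<in> Hy"
  using lw_Hy[of P] unfolding mulH_Eel Hy_iff by (intro keys_closed) auto

lemma Lw_Hy: "good u \<Longrightarrow> Lw u \<in> Hy"
  by (induction rule: good_induct) (auto simp: lw_Hy mulH_Eel_Hy, auto simp: Hy_iff)

lemma L_Hy: "P \<in> Hy \<Longrightarrow> L P \<in> Hy"
  unfolding L_def by (rule linH_Hy) (simp_all add: Lw_Hy)

lemma L_add: "L (P + Q) = L P + L Q"
  by (simp add: L_def Hm.lext_add)

lemma L_smultH: "L (smultH c P) = smultH c (L P)"
  by (simp add: L_def Hm.lext_smultH)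

lemma L_X: "L (lw [X] P) = lw [X] (L P)"
  by (simp add: L_def linH_lw lw_linH)

lemma mulH_linH_right: "mulH P (linH f Q) = linH (\<lambda>v. mulH P (f v)) Q"
proof -
  have "mulH P (linH f Q) = (\<Sum>v\<in>keys Q. mulH P (smultH (lookup Q v) (f v)))"
    by (simp add: linH_def[of f] mulH_linH Hm.lext_sum Hm.lext_fun_sum)
  also have "\<dots> = linH (\<lambda>v. mulH P (f v)) Q"
    unfolding linH_def[of "\<lambda>v. mulH P (f v)"]
    by (simp add: mulH_linH Hm.lext_smultH Hm.lext_fun_scale)
  finally show ?thesis .
qed

lemma L_Y: "P \<in> Hy \<Longrightarrow> L (lw [Y] P) = mulH Eel (L P)"
  unfolding L_def linH_lw mulH_linH_right
  by (intro Hm.lext_cong) (auto dest!: Hy_cases)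

lemma S_Lw: "good u \<Longrightarrow> S (Lw u) = monoH u"
proof (induction rule: good_induct)
  case Y_Nil then show ?case using Sw_Y_Nil by simp
next
  case (X_Cons w) then show ?case by (simp add: S_X Lw_Hy)
next
  case (Y_Cons w) then show ?case by (auto simp: S_Eel Lw_Hy)
qed

lemma L_Sw: "good u \<Longrightarrow> L (Sw (ind u)) = monoH u"
proof (induction rule: good_induct)
  case Y_Nil then show ?case using Sw_Y_Nil by (simp add: L_def)
next
  case (X_Cons w) then show ?case by (simp only: Sw_X L_X lw_monoH) simp
next
  case (Y_Cons w)
  show ?case unfolding Sw_Y[OF Y_Cons.hyps] L_add L_smultH L_X
      L_Y[OF Sw_ind_Hy[OF Y_Cons.hyps]] Y_Cons.IH mulH_Eel
    by (rule poly_mapping_eqI) (simp add: lookup_add lookup_minus algebra_simps)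
qed

lemma S_L: "P \<in> H1 \<Longrightarrow> S (L P) = P"
proof -
  assume P: "P \<in> H1"
  have "S (L P) = linH (\<lambda>u. S (Lw u)) P" by (simp add: S_def L_def Hm.lext_linH)
  also have "\<dots> = linH monoH P"
    by (intro Hm.lext_cong) (use P in \<open>auto dest!: H1_cases simp: S_Lw\<close>)
  finally show ?thesis by simp
qed

lemma L_S: "P \<in> H1 \<Longrightarrow> L (S P) = P"
proof -
  assume P: "P \<in> H1"
  have "L (S P) = linH (\<lambda>u. L (Sw (ind u))) P" by (simp add: S_def L_def Hm.lext_linH)
  also have "\<dots> = linH monoH P"
    by (intro Hm.lext_cong) (use P in \<open>auto dest!: H1_cases simp: L_Sw, auto simp: L_def\<close>)
  finally show ?thesis by simp
qed

lemma H1_iff: "P \<in> H1 \<longleftrightarrow> keys P \<subseteq> insert [] {u. good u}"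
  by (auto simp: H1_def good_def)

lemma L_H1: "P \<in> H1 \<Longrightarrow> L P \<in> H1"
  unfolding L_def H1_iff
proof (rule keys_linH_subset)
  fix u assume "keys P \<subseteq> insert [] {u. good u}" "u \<in> keys P"
  then consider "u = []" | "good u" by auto
  then show "keys (Lw u) \<subseteq> insert [] {u. good u}"
    using Lw_Hy[of u] by cases (auto simp: Hy_iff)
qed

text \<open>\<open>L\<close> maps \<open>H1\<close> to itself and is a two-sided inverse of
  \<open>S\<close> there, so the preimage chosen by \<open>inv_into\<close> is forced.\<close>

lemma Sinv_eq_L: "P \<in> H1 \<Longrightarrow> Sinv P = L P"
  unfolding Sinv_def
  by (rule inv_into_f_eq) (auto intro!: inj_on_inverseI[of _ L] simp: L_S L_H1 S_L)

lemma S_Sinv: "P \<in> H1 \<Longrightarrow> S (Sinv P) = P"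
  by (simp add: Sinv_eq_L S_L)

text \<open>Membership in \<open>Hy\<close> is carried along because the inductive step uses
  \<open>S_Eel\<close>.\<close>

lemma S_powH_Eel: "S (mulH (powH Eel n) (monoH [Y])) = monoH (replicate (Suc n) Y)
    \<and> mulH (powH Eel n) (monoH [Y]) \<in> Hy"
proof (induction n)
  case 0
  have "monoH [Y] \<in> Hy" by (simp add: Hy_iff)
  then show ?case using Sw_Y_Nil by (simp add: mulH_monoH_left)
next
  case (Suc n)
  then show ?case by (simp add: mulH_assoc S_Eel mulH_Eel_Hy)
qed

section \<open>Reduction to the case \<open>t = 0\<close>\<close>

lemma map_poly_add':
  assumes "f 0 = 0" "\<And>a b. f (a + b) = f a + f b"
  shows "map_poly f (p + q) = map_poly f p + map_poly f q"
  by (rule poly_eqI) (simp add: coeff_map_poly assms)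

lemma map_poly_mult':
  fixes f :: "'a::comm_semiring_1 \<Rightarrow> 'b::comm_semiring_1"
  assumes "f 0 = 0" "\<And>a b. f (a + b) = f a + f b" "\<And>a b. f (a * b) = f a * f b"
  shows "map_poly f (p * q) = map_poly f p * map_poly f q"
proof (rule poly_eqI)
  fix n
  have s: "f (sum g A) = (\<Sum>i\<in>A. f (g i))" for g and A :: "nat set"
    by (induction A rule: infinite_finite_induct) (simp_all add: assms)
  show "coeff (map_poly f (p * q)) n = coeff (map_poly f p * map_poly f q) n"
    by (simp add: coeff_map_poly coeff_mult assms s)
qed

definition hsub :: "rat poly \<Rightarrow> rat fps" where
  "hsub a = poly (map_poly fps_const a) (1 - fps_X)"

lemma hsub_add: "hsub (a + b) = hsub a + hsub b"
  by (simp add: hsub_def map_poly_add')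

lemma hsub_mult: "hsub (a * b) = hsub a * hsub b"
  by (simp add: hsub_def map_poly_mult')

lemma hsub_0 [simp]: "hsub 0 = 0" and hsub_1 [simp]: "hsub 1 = 1"
  by (simp_all add: hsub_def)

lemma fsub_hsub: "fsub c = map_poly hsub c"
  by (simp add: fsub_def hsub_def[abs_def])

lemma fsub_add: "fsub (a + b) = fsub a + fsub b"
  by (simp add: fsub_hsub map_poly_add' hsub_add)

lemma fsub_mult: "fsub (a * b) = fsub a * fsub b"
  by (simp add: fsub_hsub map_poly_mult' hsub_add hsub_mult)

lemma fsub_1: "fsub 1 = 1"
  by (simp add: fsub_hsub)

lemma fsub_power: "fsub (a ^ n) = fsub a ^ n"
  by (induction n) (simp_all add: fsub_1 fsub_mult)

lemma fsub_hb: "fsub hb = [:1 - fps_X:]"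
  by (simp add: fsub_hsub hb_def map_poly_pCons hsub_def)

lemma fsub_tv: "fsub tv = [:0, 1:]"
  by (simp add: fsub_hsub tv_def map_poly_pCons)

definition wext :: "(letter list \<Rightarrow> rat fps poly) \<Rightarrow> H \<Rightarrow> rat fps poly" where
  "wext g P = (\<Sum>u\<in>keys P. fsub (lookup P u) * g u)"

interpretation We: coef_module "\<lambda>c x. fsub c * x :: rat fps poly"
  rewrites "coef_module.lext (\<lambda>c x. fsub c * x :: rat fps poly) = wext"
proof -
  show *: "coef_module (\<lambda>c x. fsub c * x :: rat fps poly)"
    by unfold_locales (auto simp: fsub_add fsub_mult fsub_1 algebra_simps)
  show "coef_module.lext (\<lambda>c x. fsub c * x :: rat fps poly) = wext"
    by (intro ext) (simp add: coef_module.lext_def[OF *] wext_def)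
qed

lemma wext_lw: "wext g (lw a P) = wext (\<lambda>u. g (a @ u)) P"
  by (simp add: lw_def We.lext_linH)

lemma wext_fun_mult_left: "wext (\<lambda>u. c * g u) P = c * wext g P"
  by (simp add: wext_def sum_distrib_left mult_ac)

text \<open>Evaluation at t = 0; it is meaningful on words whose first index is at least 2.\<close>

definition Z1 :: "letter list \<Rightarrow> rat fps poly" where "Z1 u = [:zq (ind u):]"

section \<open>Box fillings and the expansion of \<open>S\<close>\<close>

lemma sum_lists_Suc:
  fixes h :: "nat list \<Rightarrow> 'a::ab_group_add"
  shows "(\<Sum>cs\<in>{cs. length cs = Suc n \<and> set cs \<subseteq> {0, 1, 2}}. h cs)
    = (\<Sum>cs\<in>{cs. length cs = n \<and> set cs \<subseteq> {0, 1, 2}}. h (0 # cs) + h (1 # cs) + h (2 # cs))"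
proof -
  let ?C = "{cs :: nat list. length cs = n \<and> set cs \<subseteq> {0, 1, 2}}"
  have fin: "finite ?C" using finite_lists_length_eq[of "{0,1,2::nat}" n] by (simp add: conj_commute)
  have "{cs :: nat list. length cs = Suc n \<and> set cs \<subseteq> {0, 1, 2}}
      = (#) 0 ` ?C \<union> (#) 1 ` ?C \<union> (#) 2 ` ?C"
    by (auto simp: length_Suc_conv image_iff)
  then have "(\<Sum>cs\<in>{cs. length cs = Suc n \<and> set cs \<subseteq> {0, 1, 2}}. h cs)
      = sum h ((#) 0 ` ?C) + sum h ((#) 1 ` ?C) + sum h ((#) 2 ` ?C)"
  proof (simp only:)
    have "sum h ((#) 0 ` ?C \<union> (#) 1 ` ?C \<union> (#) 2 ` ?C) = sum h ((#) 0 ` ?C \<union> (#) 1 ` ?C) + sum h ((#) 2 ` ?C)"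
      by (rule sum.union_disjoint) (use fin in auto)
    also have "sum h ((#) 0 ` ?C \<union> (#) 1 ` ?C) = sum h ((#) 0 ` ?C) + sum h ((#) 1 ` ?C)"
      by (rule sum.union_disjoint) (use fin in auto)
    finally show "sum h ((#) 0 ` ?C \<union> (#) 1 ` ?C \<union> (#) 2 ` ?C)
      = sum h ((#) 0 ` ?C) + sum h ((#) 1 ` ?C) + sum h ((#) 2 ` ?C)" .
  qed
  then show ?thesis
    by (simp add: sum.reindex inj_on_def sum.distrib)
qed

text \<open>Filling never increases depth or weight, so the natural-number subtractions in
  \<open>zqt\<close> are genuine.\<close>

lemma fill_props:
  assumes "ks \<noteq> []" "\<forall>k\<in>set ks. 1 \<le> k"
  shows "fill ks cs \<noteq> []" "\<forall>k\<in>set (fill ks cs). 1 \<le> k" "length (fill ks cs) \<le> length ks"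
    "sum_list (fill ks cs) \<le> sum_list ks"
proof -
  have "fill ks cs \<noteq> [] \<and> (\<forall>k\<in>set (fill ks cs). 1 \<le> k) \<and> length (fill ks cs) \<le> length ks
      \<and> sum_list (fill ks cs) \<le> sum_list ks"
    using assms
  proof (induction ks cs rule: fill.induct)
    case (3 k1 k2 ks cs)
    define F where "F = fill (k2 # ks) (tl cs)"
    have "\<forall>k\<in>set (k2 # ks). 1 \<le> k" using "3.prems"(2) by simp
    then have IH: "F \<noteq> []" "\<forall>k\<in>set F. 1 \<le> k" "length F \<le> length (k2 # ks)"
      "sum_list F \<le> sum_list (k2 # ks)"
      using "3.IH"[OF list.distinct(2)] unfolding F_def by blast+
    then obtain p ps where f: "F = p # ps" by (cases F) auto
    have "1 \<le> k1" "1 \<le> p" using "3.prems"(2) IH(2) f by auto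
    then show ?case using IH unfolding fill.simps F_def[symmetric] f by auto
  qed auto
  then show "fill ks cs \<noteq> []" "\<forall>k\<in>set (fill ks cs). 1 \<le> k" "length (fill ks cs) \<le> length ks"
    "sum_list (fill ks cs) \<le> sum_list ks" by blast+
qed

text \<open>The three symbols correspond to the terms of the recursion: the comma to the product
  with z_k, and "+" and "-1+" to the two terms of the circle action. A merge costs a factor t, and
  "-1+" also a factor hbar.\<close>

lemma Sw_fill:
  assumes "ks \<noteq> []" "\<forall>k\<in>set ks. 1 \<le> k"
  shows "Sw ks = (\<Sum>cs\<in>{cs. length cs = length ks - 1 \<and> set cs \<subseteq> {0, 1, 2}}.
      smultH (tv ^ (length ks - length (fill ks cs)) * hb ^ (sum_list ks - sum_list (fill ks cs)))
        (monoH (zw (fill ks cs))))"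
  using assms
proof (induction ks rule: induct_list012)
  case (2 k)
  have "{cs. length cs = length [k] - 1 \<and> set cs \<subseteq> {0, 1, 2 :: nat}} = {[]}" by auto
  then show ?case by (simp add: zcons_lw circH_def circw_def zw_def)
next
  case (3 k1 k2 ks)
  let ?g = "\<lambda>ks cs. smultH (tv ^ (length ks - length (fill ks cs))
      * hb ^ (sum_list ks - sum_list (fill ks cs))) (monoH (zw (fill ks cs)))"
  let ?C = "{cs. length cs = length ks \<and> set cs \<subseteq> {0, 1, 2 :: nat}}"
  have IH: "Sw (k2 # ks) = (\<Sum>cs\<in>?C. ?g (k2 # ks) cs)" using "3.IH"(2) "3.prems"(2) by simp
  have step: "zcons k1 (?g (k2 # ks) cs) + smultH tv (circH k1 (?g (k2 # ks) cs))
      = ?g (k1 # k2 # ks) (0 # cs) + ?g (k1 # k2 # ks) (1 # cs) + ?g (k1 # k2 # ks) (2 # cs)" for cs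
  proof -
    have q: "k2 # ks \<noteq> []" "\<forall>k\<in>set (k2 # ks). 1 \<le> k" using "3.prems"(2) by simp_all
    have pr: "fill (k2 # ks) cs \<noteq> []" "\<forall>k\<in>set (fill (k2 # ks) cs). 1 \<le> k"
      "length (fill (k2 # ks) cs) \<le> Suc (length ks)"
      "sum_list (fill (k2 # ks) cs) \<le> k2 + sum_list ks"
      using fill_props[OF q] by simp_all
    then obtain p ps where f: "fill (k2 # ks) cs = p # ps" by (cases "fill (k2 # ks) cs") auto
    have p: "1 \<le> p" "\<forall>k\<in>set (p # ps). 1 \<le> k" using pr f by auto
    \<comment> \<open>a and b are the depth and the weight lost in the tail; a merge with the new
      first index raises a by one, and "-1+" raises b as well.\<close>
    define a where "a = length ks - length ps"
    define b where "b = k2 + sum_list ks - (p + sum_list ps)"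
    have e1: "Suc (length ks) - length ps = Suc a" using pr f by (simp add: a_def)
    have e2: "k1 + (k2 + sum_list ks) - (k1 + p - 1 + sum_list ps) = Suc b"
      using pr f p "3.prems"(2) by (simp add: b_def)
    have e3: "k1 + (k2 + sum_list ks) - (k1 + p + sum_list ps) = b" by (simp add: b_def)
    define c where "c = tv ^ a * hb ^ b"
    have g: "?g (k2 # ks) cs = smultH c (monoH (zw (p # ps)))"
      by (simp add: f a_def b_def c_def)
    have g0: "?g (k1 # k2 # ks) (0 # cs) = smultH c (monoH (zw (k1 # p # ps)))"
      by (simp add: f a_def b_def c_def)
    have g1: "?g (k1 # k2 # ks) (1 # cs) = smultH (tv * c) (monoH (zw ((k1 + p) # ps)))"
      using e1 e3 by (simp add: f c_def mult.assoc)
    have g2: "?g (k1 # k2 # ks) (2 # cs) = smultH (tv * (c * hb)) (monoH (zw ((k1 + p - 1) # ps)))"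
      using e1 e2 by (simp add: f c_def mult_ac)
    have "circH k1 (smultH c (monoH (zw (p # ps)))) = smultH c (monoH (zw ((k1 + p) # ps)))
        + smultH (c * hb) (monoH (zw ((k1 + p - 1) # ps)))"
      using ind_zw[OF p(2)]
      by (simp add: circH_def Hm.lext_smultH circw_def Hm.scale_right_distrib)
    then show ?thesis
      unfolding g g0 g1 g2 by (simp add: zcons_lw lw_smultH zw_def Hm.scale_right_distrib)
  qed
  have "Sw (k1 # k2 # ks) = (\<Sum>cs\<in>?C. zcons k1 (?g (k2 # ks) cs) + smultH tv (circH k1 (?g (k2 # ks) cs)))"
    unfolding Sw.simps(2)[of k1] IH
    by (simp add: zcons_lw lw_def circH_def Hm.lext_sum Hm.scale_sum_right sum.distrib)
  also have "\<dots> = (\<Sum>cs\<in>{cs. length cs = Suc (length ks) \<and> set cs \<subseteq> {0, 1, 2}}. ?g (k1 # k2 # ks) cs)"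
    unfolding step sum_lists_Suc ..
  finally show ?case by simp
qed simp

text \<open>The factor hbar of each "-1+" becomes 1 - q, which is the weight correction in
  \<open>zqt\<close>. Interpolation by t is thus composition with \<open>S\<close>.\<close>

lemma zqt_eq:
  assumes "ks \<noteq> []" "\<forall>k\<in>set ks. 1 \<le> k"
  shows "zqt ks = wext Z1 (Sw ks)"
proof -
  have m: "monom (a * b) n = [:0, 1:] ^ n * [:a:] * [:b :: rat fps:]" for a b n
    by (simp add: monom_altdef mult.commute)
  show ?thesis
    unfolding Sw_fill[OF assms] We.lext_sum We.lext_smultH We.lext_monoH zqt_def
    by (intro sum.cong refl)
       (use fill_props[OF assms] in \<open>simp add: Z1_def ind_zw m fsub_mult fsub_power fsub_hb fsub_tv
         poly_const_pow\<close>)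
qed

text \<open>The span xHy, on whose words \<open>Zw\<close> does not take its default value
  0.\<close>

definition H0x :: "H set" where
  "H0x = {P. keys P \<subseteq> {X # u | u. good u}}"

lemma H0x_H1: "P \<in> H0x \<Longrightarrow> P \<in> H1"
  by (auto simp: H0x_def H1_iff subset_iff)

lemma Zqt_eq: "P \<in> H0x \<Longrightarrow> Zqt P = wext Z1 (S P)"
proof -
  assume P: "P \<in> H0x"
  have "Zqt P = wext Zw P" by (simp add: Zqt_def wext_def)
  also have "\<dots> = wext (\<lambda>u. wext Z1 (Sw (ind u))) P"
  proof (rule We.lext_cong)
    fix u assume "u \<in> keys P"
    then obtain w where u: "u = X # w" "good w" using P by (auto simp: H0x_def)
    then have g: "good u" by simp
    then have "Zw u = zqt (ind u)" using u by (simp add: Zw_def good_def)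
    then show "Zw u = wext Z1 (Sw (ind u))"
      using zqt_eq[OF ind_ne_Nil[OF g]] ind_pos by auto
  qed
  finally show ?thesis by (simp add: S_def We.lext_linH)
qed

lemma L_H0x: "P \<in> H0x \<Longrightarrow> L P \<in> H0x"
  unfolding L_def H0x_def mem_Collect_eq
proof (rule keys_linH_subset)
  fix u assume "keys P \<subseteq> {X # u | u. good u}" "u \<in> keys P"
  then obtain w where u: "u = X # w" "good w" by auto
  have "keys (Lw w) \<subseteq> {u. good u}" using Lw_Hy[OF u(2)] by (simp add: Hy_iff)
  then show "keys (Lw u) \<subseteq> {X # u | u. good u}"
    unfolding u Lw.simps by (intro keys_lw_subset) auto
qed

text \<open>The \<open>S\<close> hidden in \<open>Zqt\<close> cancels the inverse, so only the
  evaluation at t = 0 remains.\<close>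

lemma Zqt_Sinv: "P \<in> H0x \<Longrightarrow> Zqt (Sinv P) = wext Z1 P"
  by (simp add: Sinv_eq_L H0x_H1 Zqt_eq L_H0x S_L)

section \<open>Truncated evaluation\<close>

definition fq :: "nat \<Rightarrow> nat \<Rightarrow> rat fps" where
  "fq k r = fps_X ^ ((k - 1) * r) * iq r ^ k"

lemma const_poly_add: "[:a + b:] = [:a:] + [:b:]"
  by simp

lemma const_poly_sum: "[:\<Sum>i\<in>I. f i:] = (\<Sum>i\<in>I. [:f i:])"
proof (induction I rule: infinite_finite_induct)
  case (insert i I)
  have "[:f i + sum f I:] = [:f i:] + [:sum f I:]" by simp
  then show ?case by (simp only: sum.insert[OF insert(1,2)] insert(3))
qed simp_all

lemma wext_nsum_zcons:
  assumes "1 \<le> k"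
  shows "wext (\<lambda>u. [:nsum fq n (ind u):]) (zcons k P)
    = (\<Sum>r=1..n. [:fq k r:] * wext (\<lambda>u. [:nsum fq (r - 1) (ind u):]) P)"
proof -
  have "wext (\<lambda>u. [:nsum fq n (ind u):]) (zcons k P)
      = wext (\<lambda>u. \<Sum>r=1..n. [:fq k r:] * [:nsum fq (r - 1) (ind u):]) P"
    by (simp add: zcons_lw wext_lw ind_z_append[OF assms] const_poly_sum mult.commute)
  then show ?thesis by (simp only: We.lext_fun_sum wext_fun_mult_left)
qed

text \<open>Because 1/[r] = q^r/[r] + (1 - q); this is the product z_i circ_+ z_j with hbar = 1 -
  q.\<close>

lemma fq_mult:
  assumes "1 \<le> i" "1 \<le> j" "1 \<le> r"
  shows "fq i r * fq j r = fq (i + j) r + (1 - fps_X) * fq (i + j - 1) r"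
proof -
  obtain a b where ab: "i = Suc a" "j = Suc b" using assms by (metis Suc_le_D One_nat_def)
  have "(1 - fps_X ^ r) * iq r = (1 - fps_X) * (qint r * iq r)"
    by (simp add: qint_mult[symmetric] mult.assoc)
  then have q: "(1 - fps_X ^ r) * iq r = 1 - fps_X" using qint_iq assms by simp
  have X: "fps_X ^ ((a + b) * r) = fps_X ^ (a * r) * (fps_X :: rat fps) ^ (b * r)"
    by (simp add: distrib_right power_add)
  have "fq i r * fq j r = fps_X ^ ((a + b) * r) * iq r ^ (a + b + 1) * iq r"
    unfolding X by (simp add: fq_def ab power_add mult_ac)
  moreover have "fq (i + j) r = fps_X ^ ((a + b) * r) * iq r ^ (a + b + 1) * (fps_X ^ r * iq r)"
    by (simp add: fq_def ab power_add mult_ac)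
  moreover have "fq (i + j - 1) r = fps_X ^ ((a + b) * r) * iq r ^ (a + b + 1)"
    by (simp add: fq_def ab)
  ultimately have "fq i r * fq j r - fq (i + j) r = fq (i + j - 1) r * ((1 - fps_X ^ r) * iq r)"
    by (simp add: algebra_simps)
  then show ?thesis unfolding q by (simp add: algebra_simps)
qed

text \<open>Same splitting as for the harmonic product, with \<open>fq_mult\<close> accounting for
  the two diagonal terms; the identity is exact for each cut-off n.\<close>

lemma wext_nsum_harmP:
  assumes "\<forall>k\<in>set u. 1 \<le> k" "\<forall>k\<in>set v. 1 \<le> k"
  shows "wext (\<lambda>w. [:nsum fq n (ind w):]) (harmP u v) = [:nsum fq n u * nsum fq n v:]"
  using assms
proof (induction u v arbitrary: n rule: harmP.induct)
  case (1 v)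
  then show ?case by (simp add: ind_zw)
next
  case (2 i u)
  then show ?case by (simp add: ind_zw del: nsum.simps(2))
next
  case (3 i u j v)
  have ij: "1 \<le> i" "1 \<le> j" "1 \<le> i + j" "1 \<le> i + j - 1" using "3.prems" by auto
  have f: "fq i r * fq j r * x = fq (i + j) r * x + (1 - fps_X) * (fq (i + j - 1) r * x)"
    if "1 \<le> r" for r x by (simp only: fq_mult[OF ij(1,2) that] distrib_right mult.assoc)
  have "wext (\<lambda>w. [:nsum fq n (ind w):]) (harmP (i # u) (j # v)) =
    (\<Sum>r=1..n. [:fq i r:] * [:nsum fq (r - 1) u * nsum fq (r - 1) (j # v):])
    + (\<Sum>r=1..n. [:fq j r:] * [:nsum fq (r - 1) (i # u) * nsum fq (r - 1) v:])
    + (\<Sum>r=1..n. [:fq (i + j) r:] * [:nsum fq (r - 1) u * nsum fq (r - 1) v:])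
    + [:1 - fps_X:] * (\<Sum>r=1..n. [:fq (i + j - 1) r:] * [:nsum fq (r - 1) u * nsum fq (r - 1) v:])"
    using 3 unfolding harmP.simps We.lext_add We.lext_smultH fsub_hb
      wext_nsum_zcons[OF ij(1)] wext_nsum_zcons[OF ij(2)] wext_nsum_zcons[OF ij(3)]
      wext_nsum_zcons[OF ij(4)]
    by (simp del: nsum.simps)
  also have "\<dots> = [:(\<Sum>r=1..n. fq i r * (nsum fq (r - 1) u * nsum fq (r - 1) (j # v)))
    + (\<Sum>r=1..n. fq j r * (nsum fq (r - 1) (i # u) * nsum fq (r - 1) v))
    + ((\<Sum>r=1..n. fq (i + j) r * (nsum fq (r - 1) u * nsum fq (r - 1) v))
    + (1 - fps_X) * (\<Sum>r=1..n. fq (i + j - 1) r * (nsum fq (r - 1) u * nsum fq (r - 1) v))):]"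
    by (simp add: const_poly_sum[symmetric] mult.commute del: nsum.simps)
  also have "\<dots> = [:nsum fq n (i # u) * nsum fq n (j # v):]"
    unfolding nsum_Cons_mult_Cons sum_distrib_left sum.distrib[symmetric]
    by (intro arg_cong[where f = "\<lambda>x. [:x:]"] sum.cong refl) (simp add: f del: nsum.simps)
  finally show ?case .
qed

text \<open>Splitting off the largest entry turns the sum over tuples in \<open>zq\<close> into the
  recursion of \<open>nsum\<close>.\<close>

lemma sum_strict_tuples:
  "(\<Sum>ms\<in>{ms. length ms = length ks \<and> sorted_wrt (>) ms \<and> (\<forall>m\<in>set ms. 1 \<le> m) \<and> (\<forall>m\<in>set ms. m \<le> n)}.
     \<Prod>a<length ks. f (ks ! a) (ms ! a)) = nsum f n ks"
proof (induction ks arbitrary: n)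
  case Nil
  have "{ms. length ms = length ([] :: nat list) \<and> sorted_wrt (>) ms \<and> (\<forall>m\<in>set ms. 1 \<le> m)
      \<and> (\<forall>m\<in>set ms. m \<le> n)} = {[] :: nat list}" by auto
  then show ?case by simp
next
  case (Cons k ks)
  let ?T = "\<lambda>l n. {ms :: nat list. length ms = l \<and> sorted_wrt (>) ms \<and> (\<forall>m\<in>set ms. 1 \<le> m) \<and> (\<forall>m\<in>set ms. m \<le> n)}"
  have fin: "finite (?T l n)" for l n
    by (rule finite_subset[OF _ finite_lists_length_eq[of "{..n}" l]]) auto
  have T: "?T (length (k # ks)) n = (\<Union>r\<in>{1..n}. (#) r ` ?T (length ks) (r - 1))"
  proof (intro equalityI subsetI)
    fix ms assume "ms \<in> ?T (length (k # ks)) n"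
    then show "ms \<in> (\<Union>r\<in>{1..n}. (#) r ` ?T (length ks) (r - 1))"
      by (cases ms) (auto simp: image_iff)
  next
    fix ms assume "ms \<in> (\<Union>r\<in>{1..n}. (#) r ` ?T (length ks) (r - 1))"
    then show "ms \<in> ?T (length (k # ks)) n" by fastforce
  qed
  have "(\<Sum>ms\<in>?T (length (k # ks)) n. \<Prod>a<length (k # ks). f ((k # ks) ! a) (ms ! a))
    = (\<Sum>r=1..n. \<Sum>ms\<in>(#) r ` ?T (length ks) (r - 1). \<Prod>a<length (k # ks). f ((k # ks) ! a) (ms ! a))"
    unfolding T using fin by (intro sum.UNION_disjoint) auto
  also have "\<dots> = (\<Sum>r=1..n. f k r * nsum f (r - 1) ks)"
  proof (intro sum.cong refl)
    fix r
    have "(\<Sum>ms\<in>(#) r ` ?T (length ks) (r - 1). \<Prod>a<length (k # ks). f ((k # ks) ! a) (ms ! a))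
      = (\<Sum>ms\<in>?T (length ks) (r - 1). f k r * (\<Prod>a<length ks. f (ks ! a) (ms ! a)))"
      by (simp add: sum.reindex prod.lessThan_Suc_shift del: prod.lessThan_Suc)
    also have "\<dots> = f k r * nsum f (r - 1) ks"
      by (simp add: sum_distrib_left[symmetric] Cons.IH[symmetric])
    finally show "(\<Sum>ms\<in>(#) r ` ?T (length ks) (r - 1). \<Prod>a<length (k # ks). f ((k # ks) ! a) (ms ! a))
      = f k r * nsum f (r - 1) ks" .
  qed
  finally show ?case by simp
qed

lemma zq_nth: "fps_nth (zq ks) n = fps_nth (nsum fq n ks) n"
proof -
  have "fps_nth (zq ks) n = fps_nth (\<Sum>ms\<in>{ms. length ms = length ks \<and> sorted_wrt (>) ms
      \<and> (\<forall>m\<in>set ms. 1 \<le> m) \<and> (\<forall>m\<in>set ms. m \<le> n)}. \<Prod>a<length ks. fq (ks ! a) (ms ! a)) n"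
    by (simp add: zq_def fq_def iq_def fps_sum_nth)
  then show ?thesis by (simp only: sum_strict_tuples)
qed

text \<open>As k \<ge> 2, the terms with largest variable r have order at least r in q, so those
  beyond N do not reach q^N.\<close>

lemma zq_cong:
  assumes "2 \<le> k"
  shows "fps_X ^ M dvd zq (k # ks) - nsum fq M (k # ks)"
  unfolding X_power_dvd_fps_iff
proof (intro allI impI)
  fix N assume N: "N < M"
  have "nsum fq M (k # ks) = nsum fq N (k # ks) + (\<Sum>r=Suc N..M. fq k r * nsum fq (r - 1) ks)"
    unfolding nsum.simps using N sum.ub_add_nat[of 1 N "\<lambda>r. fq k r * nsum fq (r - 1) ks" "M - N"]
    by simp
  moreover have "fps_nth (fq k r * x) N = 0" if "Suc N \<le> r" for r x
  proof -
    have "1 * r \<le> (k - 1) * r" using assms by (intro mult_le_mono1) auto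
    then have "N < (k - 1) * r" using that by linarith
    then show ?thesis by (simp add: fq_def mult.assoc fps_X_power_mult_nth)
  qed
  ultimately show "fps_nth (zq (k # ks) - nsum fq M (k # ks)) N = 0"
    by (simp add: zq_nth fps_sum_nth del: nsum.simps)
qed

lemma wext_dvd:
  "(\<And>u. u \<in> keys P \<Longrightarrow> d dvd g u - h u) \<Longrightarrow> d dvd wext g P - wext h P"
  unfolding wext_def sum_subtractf[symmetric] right_diff_distrib[symmetric]
  by (intro dvd_sum dvd_mult) auto

lemma keys_harmP:
  "\<forall>k\<in>set u. 1 \<le> k \<Longrightarrow> \<forall>k\<in>set v. 1 \<le> k \<Longrightarrow> keys (harmP u v) \<subseteq> insert [] {u. good u}"
proof (induction u v rule: harmP.induct)
  case (1 v) then show ?case using zw_good[of v] by (cases v) (auto simp: zw_def)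
next
  case (2 i u) then show ?case using zw_good[of "i # u"] by auto
next
  case (3 i u j v)
  have z: "keys (zcons k P) \<subseteq> insert [] {u. good u}" if "keys P \<subseteq> insert [] {u. good u}" for k P
    unfolding zcons_lw using that by (intro keys_lw_subset) (auto simp: good_def z_def subset_iff)
  show ?case unfolding harmP.simps using 3 by (intro keys_closed z) auto
qed

lemma keys_oastw:
  assumes "\<forall>k\<in>set u. 1 \<le> k" "\<forall>k\<in>set v. 1 \<le> k"
  shows "keys (oastw u v) \<subseteq> {X # u | u. good u}"
proof (cases "u = [] \<or> v = []")
  case True then show ?thesis by (cases u; cases v) auto
next
  case False
  then obtain i u' j v' where e: "u = i # u'" "v = j # v'" by (metis neq_Nil_conv)
  have ij: "1 \<le> i" "1 \<le> j" using assms e by auto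
  \<comment> \<open>i + j \<ge> 2 puts an x in front, so that \<open>oast\<close> lands in
    xHy.\<close>
  then have z: "z (i + j) = X # z (i + j - 1)" using z_Suc[of "i + j - 1"] by simp
  have h: "keys (harmP u' v') \<subseteq> insert [] {u. good u}" using keys_harmP[of u' v'] assms e by simp
  have g: "good (z k @ w)" if "w = [] \<or> good w" for k w using that by (auto simp: good_def z_def)
  show ?thesis unfolding e oastw.simps zcons_lw z
    using h g by (intro keys_lw_subset) (auto simp: subset_iff)
qed

lemma oast_H0x: "oast P Q \<in> H0x"
  unfolding oast_def bilinH_linH H0x_def mem_Collect_eq
  by (intro keys_linH_subset keys_oastw) (auto dest: ind_pos)

lemma Z1_cong:
  assumes "P \<in> H0x"
  shows "[:fps_X ^ M:] dvd wext Z1 P - wext (\<lambda>u. [:nsum fq M (ind u):]) P"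
proof (rule wext_dvd)
  fix u assume "u \<in> keys P"
  then obtain w where u: "u = X # w" "good w" using assms by (auto simp: H0x_def)
  then obtain k ks where k: "ind w = k # ks" using ind_good by blast
  have "1 \<le> k" using ind_pos[of k w] k by simp
  then show "[:fps_X ^ M:] dvd Z1 u - [:nsum fq M (ind u):]"
    using zq_cong[of "Suc k" M ks] u k by (simp add: Z1_def del: nsum.simps)
qed

lemma ind_replicate: "ind (replicate i Y) = replicate i 1"
  by (induction i) auto

text \<open>\<open>oast\<close> adds the first indices and multiplies the tails by
  \<open>harmP\<close>; for a fixed largest variable r the evaluation therefore factors into the
  contributions of the two arguments.\<close>

lemma wext_oast:
  assumes "P \<in> Hy" "1 \<le> i"
  shows "wext (\<lambda>u. [:nsum fq M (ind u):]) (oast P (monoH (replicate i Y)))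
    = (\<Sum>r=1..M. [:fps_X ^ r * nterm fq r (replicate i 1):] * wext (\<lambda>u. [:nterm fq r (ind u):]) P)"
proof -
  obtain j where i: "i = Suc j" using assms(2) by (cases i) auto
  have "wext (\<lambda>u. [:nsum fq M (ind u):]) (oast P (monoH (replicate i Y)))
      = wext (\<lambda>a. wext (\<lambda>u. [:nsum fq M (ind u):]) (oastw (ind a) (replicate i 1))) P"
    by (simp add: oast_def bilinH_linH We.lext_linH ind_replicate)
  also have "\<dots> = wext (\<lambda>a. \<Sum>r=1..M. [:fps_X ^ r * nterm fq r (replicate i 1):]
      * [:nterm fq r (ind a):]) P"
  proof (rule We.lext_cong)
    fix a assume "a \<in> keys P"
    then have "good a" using assms(1) by (rule Hy_cases[rotated])
    then obtain k ks where k: "ind a = k # ks" using ind_good by blast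
    have kp: "1 \<le> k" and ksp: "\<forall>k\<in>set ks. 1 \<le> k" using ind_pos[of _ a] k by auto
    then obtain k' where k': "k = Suc k'" by (cases k) auto
    \<comment> \<open>Joining the indices k and 1 raises the power of q by r, whence the extra
      factor q^r.\<close>
    have f: "fq (Suc k) r = fps_X ^ r * fq 1 r * fq k r" for r
      by (simp add: fq_def k' power_add mult_ac)
    have rp: "\<forall>l\<in>set (replicate j 1). (1::nat) \<le> l" by simp
    have "oastw (ind a) (replicate i 1) = zcons (Suc k) (harmP ks (replicate j 1))"
      by (simp add: k i)
    then have "wext (\<lambda>u. [:nsum fq M (ind u):]) (oastw (ind a) (replicate i 1))
      = (\<Sum>r=1..M. [:fq (Suc k) r:] * [:nsum fq (r - 1) ks * nsum fq (r - 1) (replicate j 1):])"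
      using wext_nsum_zcons[of "Suc k"] by (simp only: wext_nsum_harmP[OF ksp rp])
    also have "\<dots> = (\<Sum>r=1..M. [:fps_X ^ r * nterm fq r (replicate i 1):] * [:nterm fq r (ind a):])"
      by (intro sum.cong refl) (simp add: f k i mult_ac)
    finally show "wext (\<lambda>u. [:nsum fq M (ind u):]) (oastw (ind a) (replicate i 1))
      = (\<Sum>r=1..M. [:fps_X ^ r * nterm fq r (replicate i 1):] * [:nterm fq r (ind a):])" .
  qed
  finally show ?thesis by (simp only: We.lext_fun_sum wext_fun_mult_left)
qed

section \<open>Evaluation of \<open>phi\<close> and the coefficients of the Newton series\<close>

lemma phiw_Hy: "good u \<Longrightarrow> phiw u \<in> Hy"
proof (induction rule: good_induct)
  case Y_Nil
  show ?case by (simp add: mulH_uminus_left mulH_monoH_left Hy_iff keys_uminus_subset)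
next
  case (X_Cons w)
  then show ?case using lw_Hy[of "phiw w"]
    unfolding phiw.simps mulH_add_left mulH_monoH_left Hy_iff by (intro keys_add_subset)
next
  case (Y_Cons w)
  then show ?case using lw_Hy[of "phiw w"]
    unfolding phiw.simps mulH_uminus_left mulH_monoH_left Hy_iff by (intro keys_uminus_subset)
qed

lemma phi_Hy: "P \<in> Hy \<Longrightarrow> phi P \<in> Hy"
  unfolding phi_def by (rule linH_Hy) (simp_all add: phiw_Hy)

lemma nterm_fq_X: "good w \<Longrightarrow> nterm fq m (ind (X # w)) = fps_X ^ m * iq m * nterm fq m (ind w)"
proof -
  assume "good w"
  then obtain k ks where k: "ind w = k # ks" using ind_good by blast
  then have "1 \<le> k" using ind_pos[of k w] by simp
  then obtain l where "k = Suc l" by (cases k) auto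
  then show ?thesis by (simp add: k fq_def power_add mult_ac)
qed

lemma nterm_fq_Y: "nterm fq m (ind (Y # w)) = iq m * nsum fq (m - 1) (ind w)"
  by (simp add: fq_def)

lemma wext_nterm_lw_Y:
  assumes "P \<in> Hy"
  shows "wext (\<lambda>u. [:nterm fq m (ind u):]) (lw [Y] P)
    = [:iq m:] * (\<Sum>r=1..m-1. wext (\<lambda>u. [:nterm fq r (ind u):]) P)"
proof -
  have "wext (\<lambda>u. [:nterm fq m (ind u):]) (lw [Y] P)
      = wext (\<lambda>u. [:iq m:] * (\<Sum>r=1..m-1. [:nterm fq r (ind u):])) P"
    unfolding wext_lw
    by (intro We.lext_cong)
       (use assms in \<open>auto dest!: Hy_cases simp: nterm_fq_Y nsum_nterm ind_ne_Nil const_poly_sum[symmetric]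
         simp del: ind.simps nterm.simps\<close>)
  then show ?thesis by (simp only: We.lext_fun_sum wext_fun_mult_left)
qed

lemma wext_nterm_lw_X:
  assumes "P \<in> Hy"
  shows "wext (\<lambda>u. [:nterm fq m (ind u):]) (lw [X] P)
    = [:fps_X ^ m * iq m:] * wext (\<lambda>u. [:nterm fq m (ind u):]) P"
proof -
  have "wext (\<lambda>u. [:nterm fq m (ind u):]) (lw [X] P)
      = wext (\<lambda>u. [:fps_X ^ m * iq m:] * [:nterm fq m (ind u):]) P"
    unfolding wext_lw
    by (intro We.lext_cong)
       (use assms in \<open>auto dest!: Hy_cases simp: nterm_fq_X simp del: ind.simps nterm.simps\<close>)
  then show ?thesis by (simp only: wext_fun_mult_left)
qed

text \<open>A prefix x multiplies by q^m/[m], a prefix y sums over r < m and divides by [m]; with x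
  going to x + y and y to -y this is the recursion of \<open>dual_term\<close>.\<close>

lemma wext_nterm_phiw:
  "good w \<Longrightarrow> wext (\<lambda>u. [:nterm fq m (ind u):]) (phiw w) = [:dual_term w m:]"
proof (induction w arbitrary: m rule: good_induct)
  case Y_Nil
  show ?case by (simp add: mulH_uminus_left mulH_monoH_left We.lext_uminus fq_def)
next
  case (X_Cons w)
  note h = phiw_Hy[OF X_Cons.hyps]
  show ?case unfolding phiw.simps mulH_add_left mulH_monoH_left We.lext_add
      wext_nterm_lw_X[OF h] wext_nterm_lw_Y[OF h] X_Cons.IH
    by (simp add: const_poly_sum[symmetric] algebra_simps)
next
  case (Y_Cons w)
  note h = phiw_Hy[OF Y_Cons.hyps]
  have "w \<noteq> []" using Y_Cons.hyps by auto
  then show ?case unfolding phiw.simps mulH_uminus_left mulH_monoH_left We.lext_uminus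
      wext_nterm_lw_Y[OF h] Y_Cons.IH
    by (simp add: const_poly_sum[symmetric])
qed

text \<open>Both sides are the j-th elementary symmetric function of 1/[1], ..., 1/[n].\<close>

lemma coeff_prod_iq: "coeff (\<Prod>r=1..n. [:1, iq r:]) j = nsum fq n (replicate j 1)"
proof (induction n arbitrary: j)
  case 0
  then show ?case by (cases j) auto
next
  case (Suc n)
  have "coeff (\<Prod>r=1..Suc n. [:1, iq r:]) j = coeff ((\<Prod>r=1..n. [:1, iq r:]) * [:1, iq (Suc n):]) j"
    by simp
  then show ?case
    by (cases j) (simp_all add: Suc[unfolded One_nat_def] fq_def[of 1, simplified])
qed

lemma coeff_Kpoly:
  "coeff (Kpoly M w) (Suc j) = (\<Sum>r=1..M. fps_X ^ r * dual_term w r * nterm fq r (replicate (Suc j) 1))"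
  by (simp add: Kpoly_def coeff_sum coeff_prod_iq[unfolded One_nat_def] fq_def mult_ac)

text \<open>By \<open>wext_oast\<close> and \<open>coeff_Kpoly\<close>, the truncated evaluation
  equals the Newton coefficient exactly; only the truncation of \<open>zq\<close> produces an
  error.\<close>

lemma Z1_phiw_cong:
  assumes "good w"
  shows "[:fps_X ^ M:] dvd wext Z1 (oast (phiw w) (monoH (replicate (Suc j) Y)))
    - [:coeff (Kpoly M w) (Suc j):]"
proof -
  have "wext (\<lambda>u. [:nsum fq M (ind u):]) (oast (phiw w) (monoH (replicate (Suc j) Y)))
      = [:coeff (Kpoly M w) (Suc j):]"
    unfolding coeff_Kpoly const_poly_sum
    by (subst wext_oast) (simp_all add: phiw_Hy assms wext_nterm_phiw mult_ac del: replicate_Suc)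
  then show ?thesis using Z1_cong[OF oast_H0x, of M "phiw w" "monoH (replicate (Suc j) Y)"] by simp
qed

section \<open>The relation\<close>

text \<open>The coefficient of T^i in F_w(T).\<close>

definition Zphi :: "nat \<Rightarrow> letter list \<Rightarrow> rat fps poly" where
  "Zphi i w = wext Z1 (oast (phiw w) (monoH (replicate i Y)))"

lemma wext_Zphi: "wext Z1 (oast (phi P) (monoH (replicate i Y))) = wext (Zphi i) P"
  by (simp add: oast_def phi_def bilinH_linH We.lext_linH Zphi_def[abs_def] Hm.lext_linH)

lemma harm_harm_list: "harm u v = (\<Sum>ks\<leftarrow>harm_list u v. monoH (zw ks))"
proof (induction u v rule: harm_list.induct)
  case (3 i u j v)
  have "zcons k (\<Sum>ks\<leftarrow>l. monoH (zw ks)) = (\<Sum>ks\<leftarrow>l. monoH (zw (k # ks)))" for k l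
    by (induction l) (simp_all add: zcons_lw lw_add zw_def)
  then show ?case using 3 by (simp add: o_def add.assoc)
qed simp_all

lemma coeff_mult_0:
  assumes "coeff p 0 = 0" "coeff q 0 = (0 :: 'a::comm_ring_1)" "1 \<le> m"
  shows "coeff (p * q) m = (\<Sum>i\<in>{1..<m}. coeff p i * coeff q (m - i))"
proof -
  have "coeff (p * q) m = (\<Sum>i\<le>m. coeff p i * coeff q (m - i))" by (simp add: coeff_mult)
  also have "\<dots> = (\<Sum>i\<in>{1..<m}. coeff p i * coeff q (m - i))"
  proof (intro sum.mono_neutral_right ballI)
    fix i assume "i \<in> {..m} - {1..<m}"
    then have "i = 0 \<or> i = m" by auto
    then show "coeff p i * coeff q (m - i) = 0" using assms by auto
  qed auto
  finally show ?thesis .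
qed

lemma dvd_sum_list_diff:
  fixes d :: "'a::comm_ring_1"
  shows "(\<And>x. x \<in> set xs \<Longrightarrow> d dvd f x - g x) \<Longrightarrow> d dvd (\<Sum>x\<leftarrow>xs. f x) - (\<Sum>x\<leftarrow>xs. g x)"
proof (induction xs)
  case (Cons x xs)
  have "d dvd (f x - g x) + ((\<Sum>x\<leftarrow>xs. f x) - (\<Sum>x\<leftarrow>xs. g x))"
    using Cons by (intro dvd_add) auto
  then show ?case by (simp add: algebra_simps)
qed simp

lemma good_zw_harm_list:
  assumes "good v" "ks \<in> set (harm_list (ind v) (ind w))"
  shows "good (zw ks)"
  using zw_good[of ks] harm_list_pos[OF _ _ assms(2)] harm_list_ne_Nil[OF assms(2)] ind_pos
    ind_ne_Nil[OF assms(1)] by blast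

text \<open>Coefficients of T^m are compared in \<open>Kpoly_mult\<close>; each Newton coefficient
  is \<open>Zphi\<close> up to a multiple of q^M, and M is arbitrary. F_v and F_w have no constant
  term, so i and m - i are positive.\<close>

lemma Zphi_relation:
  assumes "1 \<le> m" "good v" "good w"
  shows "(\<Sum>i\<in>{1..<m}. Zphi i v * Zphi (m - i) w) = wext (Zphi m) (harm (ind v) (ind w))"
proof -
  let ?L = "harm_list (ind v) (ind w)"
  define D where "D = (\<Sum>i\<in>{1..<m}. Zphi i v * Zphi (m - i) w) - (\<Sum>ks\<leftarrow>?L. Zphi m (zw ks))"
  have "[:fps_X ^ M:] dvd D" for M
  proof -
    let ?d = "[:fps_X ^ M:] :: rat fps poly"
    let ?c = "\<lambda>w i. [:coeff (Kpoly M w) i:]"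
    have c: "?d dvd Zphi i w - ?c w i" if "good w" "1 \<le> i" for w i
      using Z1_phiw_cong[OF that(1), of M "i - 1"] that(2) by (simp add: Zphi_def del: replicate_Suc)
    have a: "?d dvd (\<Sum>i\<in>{1..<m}. Zphi i v * Zphi (m - i) w) - (\<Sum>i\<in>{1..<m}. ?c v i * ?c w (m - i))"
      unfolding sum_subtractf[symmetric]
    proof (rule dvd_sum)
      fix i assume i: "i \<in> {1..<m}"
      have "Zphi i v * Zphi (m - i) w - ?c v i * ?c w (m - i)
        = Zphi i v * (Zphi (m - i) w - ?c w (m - i)) + (Zphi i v - ?c v i) * ?c w (m - i)"
        by (simp add: algebra_simps)
      moreover have "?d dvd \<dots>" using i assms by (intro dvd_add dvd_mult dvd_mult2 c) auto
      ultimately show "?d dvd Zphi i v * Zphi (m - i) w - ?c v i * ?c w (m - i)" by simp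
    qed
    have b: "?d dvd (\<Sum>ks\<leftarrow>?L. Zphi m (zw ks)) - (\<Sum>ks\<leftarrow>?L. ?c (zw ks) m)"
      using good_zw_harm_list[OF assms(2)] assms(1)
      by (intro dvd_sum_list_diff c)
    have K0: "coeff (Kpoly M u) 0 = 0" for u by (simp add: Kpoly_def coeff_sum)
    have sl: "[:coeff (\<Sum>ks\<leftarrow>l. Kpoly M (zw ks)) m:] = (\<Sum>ks\<leftarrow>l. ?c (zw ks) m)" for l
      by (induction l) (simp_all only: list.map sum_list.Nil sum_list.Cons coeff_0 coeff_add
          const_poly_add pCons_0_0)
    have "fps_X ^ M dvd coeff (Kpoly M v * Kpoly M w - (\<Sum>ks\<leftarrow>?L. Kpoly M (zw ks))) m"
      using Kpoly_mult[OF assms(2,3), of M] by (simp add: const_poly_dvd_iff)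
    then have "?d dvd [:coeff (Kpoly M v * Kpoly M w) m:] - [:coeff (\<Sum>ks\<leftarrow>?L. Kpoly M (zw ks)) m:]"
      by simp
    then have e: "?d dvd (\<Sum>i\<in>{1..<m}. ?c v i * ?c w (m - i)) - (\<Sum>ks\<leftarrow>?L. ?c (zw ks) m)"
      unfolding sl coeff_mult_0[OF K0 K0 assms(1)] const_poly_sum by (simp add: mult.commute)
    from dvd_add[OF a dvd_diff[OF e b]] show ?thesis
      by (simp add: D_def)
  qed
  \<comment> \<open>Coefficients divisible by every power of q are zero.\<close>
  then have "fps_X ^ M dvd coeff D n" for M n by (simp add: const_poly_dvd_iff)
  then have "fps_nth (coeff D n) N = 0" for n N
    unfolding X_power_dvd_fps_iff by blast
  then have "D = 0" by (intro poly_eqI fps_ext) simp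
  then show ?thesis by (simp add: D_def harm_harm_list We.lext_sum_list)
qed

lemma Zphi_relation_Hy:
  assumes "1 \<le> m" "P \<in> Hy" "Q \<in> Hy"
  shows "(\<Sum>i\<in>{1..<m}. wext (Zphi i) P * wext (Zphi (m - i)) Q) = wext (Zphi m) (star P Q)"
proof -
  have "(\<Sum>i\<in>{1..<m}. wext (Zphi i) P * wext (Zphi (m - i)) Q)
    = wext (\<lambda>u. wext (\<lambda>v. \<Sum>i\<in>{1..<m}. Zphi i u * Zphi (m - i) v) Q) P"
    by (simp add: We.lext_fun_sum wext_fun_mult_left) (simp add: wext_def sum_distrib_right mult_ac)
  also have "\<dots> = wext (\<lambda>u. wext (\<lambda>v. wext (Zphi m) (harm (ind u) (ind v))) Q) P"
    using assms by (intro We.lext_cong Zphi_relation) (auto dest: Hy_cases)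
  finally show ?thesis by (simp add: star_def bilinH_linH We.lext_linH)
qed

lemma star_Hy: "P \<in> Hy \<Longrightarrow> Q \<in> Hy \<Longrightarrow> star P Q \<in> Hy"
  unfolding star_def bilinH_linH
proof (intro linH_Hy)
  fix u v assume uv: "good u" "good v"
  have "\<forall>ks\<in>set l. good (zw ks) \<Longrightarrow> keys (\<Sum>ks\<leftarrow>l. monoH (zw ks)) \<subseteq> {u. good u}" for l
    by (induction l) (simp_all add: keys_add_subset)
  then show "harm (ind u) (ind v) \<in> Hy" using good_zw_harm_list[OF uv(1)]
    by (simp add: harm_harm_list Hy_iff)
qed simp_all

text \<open>All occurrences of t outside \<open>S P\<close> cancel: \<open>S\<close> undoes the
  inverse in \<open>phit\<close>, sends the power of \<open>Eel\<close> times y to y^i, and is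
  itself undone by \<open>Zqt_Sinv\<close>. The minus sign is that of \<open>phit\<close>.\<close>

lemma Zqt_oastt_phit:
  assumes "P \<in> Hy" "1 \<le> i"
  shows "Zqt (oastt (phit P) (mulH (powH Eel (i - 1)) (monoH [Y]))) = - wext (Zphi i) (S P)"
proof -
  have "phi (S P) \<in> Hy" using assms by (intro phi_Hy S_Hy)
  then have "S (phit P) = - phi (S P)"
    using S_Sinv[OF Hy_H1, of "phi (S P)"] by (simp add: phit_def S_def Hm.lext_uminus)
  moreover have "S (mulH (powH Eel (i - 1)) (monoH [Y])) = monoH (replicate i Y)"
    using S_powH_Eel[of "i - 1"] assms by (simp del: replicate_Suc)
  ultimately have "oastt (phit P) (mulH (powH Eel (i - 1)) (monoH [Y]))
      = Sinv (oast (- phi (S P)) (monoH (replicate i Y)))" by (simp add: oastt_def)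
  then have "Zqt (oastt (phit P) (mulH (powH Eel (i - 1)) (monoH [Y])))
      = wext Z1 (oast (- phi (S P)) (monoH (replicate i Y)))"
    by (simp add: Zqt_Sinv oast_H0x)
  also have "\<dots> = - wext Z1 (oast (phi (S P)) (monoH (replicate i Y)))"
    by (simp add: oast_def bilinH_linH Hm.lext_uminus We.lext_uminus)
  finally show ?thesis by (simp add: wext_Zphi)
qed

theorem theorem1p2:
  fixes m :: nat and v w :: H
  assumes "m \<ge> 1" and "v \<in> Hy" and "w \<in> Hy"
  shows "(\<Sum>i\<in>{1..<m}.
            Zqt (oastt (phit v) (mulH (powH Eel (i - 1)) (monoH [Y])))
          * Zqt (oastt (phit w) (mulH (powH Eel (m - i - 1)) (monoH [Y]))))
       = - Zqt (oastt (phit (Sinv (star (S v) (S w))))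
                      (mulH (powH Eel (m - 1)) (monoH [Y])))"
proof -
  have st: "star (S v) (S w) \<in> Hy" using assms by (intro star_Hy S_Hy)
  then have "Sinv (star (S v) (S w)) \<in> Hy" by (simp add: Sinv_eq_L Hy_H1 L_Hy)
  then have r: "- Zqt (oastt (phit (Sinv (star (S v) (S w))))
      (mulH (powH Eel (m - 1)) (monoH [Y]))) = wext (Zphi m) (star (S v) (S w))"
    using assms(1) by (simp only: Zqt_oastt_phit minus_minus) (simp only: S_Sinv[OF Hy_H1[OF st]])
  show ?thesis
    unfolding r Zphi_relation_Hy[OF assms(1) S_Hy[OF assms(2)] S_Hy[OF assms(3)], symmetric]
  proof (intro sum.cong refl)
    fix i assume "i \<in> {1..<m}"
    then have "1 \<le> i" "1 \<le> m - i" by auto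
    \<comment> \<open>The minus signs of the two factors cancel here; the single one on the other
      side is absorbed in \<open>r\<close>.\<close>
    then show "Zqt (oastt (phit v) (mulH (powH Eel (i - 1)) (monoH [Y])))
        * Zqt (oastt (phit w) (mulH (powH Eel (m - i - 1)) (monoH [Y])))
      = wext (Zphi i) (S v) * wext (Zphi (m - i)) (S w)"
      using Zqt_oastt_phit[OF assms(2), of i] Zqt_oastt_phit[OF assms(3), of "m - i"]
      by (simp only: minus_mult_minus)
  qed
qed

end
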